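(* Let $K\ge 2$ be an integer, let $n\ge 1$ and $m\ge 0$ be integers, and let $\alpha=m/n$. The normalized symmetric feedback capacity (per user, with local feedback) of the symmetric $K$-user linear deterministic cyclic Z-interference channel with parameters $(n,m)$ is $$\mathcal{C}^{\mathrm{FB}}_{\mathrm{sym},\mathrm{LD}}(\alpha,K)= \begin{cases} (1-\alpha)+\frac{\alpha}{K}, & 0\leq\alpha\leq 1/2,\\ \alpha + \frac{2-3\alpha}{K}, & 1/2\leq \alpha\leq 2/3,\\ 1-\frac{\alpha}{2}, & 2/3\leq \alpha\leq 1,\\ \frac{\alpha}{2}, & 1\leq \alpha\leq 2,\\ 1+ \frac{\alpha-2}{K}, & \alpha\geq 2. \end{cases}$$
   Context: Logarithms are to base 2. User indices are cyclic modulo $K$ (so index $K+1$ means $1$). Channel. In each channel use, transmitter $k\in\{1,\dots,K\}$ sends a binary vector $X_k$ of length $\max(n,m)$, ordered from the top-most bit to the lower-most bit; $\oplus$ is bitwise addition modulo 2. The channel is memoryless and deterministic with the following outputs. If $n\ge m$: let $U_k$ be the top-most $n-m$ bits of $X_k$, $V_k$ the top-most $m$ bits of $X_k$, and $L_k$ the lower-most $m$ bits of $X_k$; receiver $k$ observes $Y_k=(U_k,\,L_k\oplus V_{k+1})$. If $n<m$: let $U_k$ be the top-most $m-n$ bits of $X_k$, $V_k$ the top-most $n$ bits of $X_k$, and $L_k$ the lower-most $n$ bits of $X_k$; receiver $k$ observes $Y_k=(U_{k+1},\,L_{k+1}\oplus V_k)$. Feedback codes (local feedback). A $(T,M_1,\dots,M_K)$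 feedback code consists of encoding functions $f_{k,t}:\{1,\dots,M_k\}\times\mathcal{Y}_k^{t-1}\to\mathcal{X}_{k}$ for $k=1,\dots,K$, $t=1,\dots,T$, and decoding functions $g_k:\mathcal{Y}_k^T\to\{1,\dots,M_k\}$. The messages $W_k$ are independent and uniform on $\{1,\dots,M_k\}$, the input at time $t$ is $X_{k,t}=f_{k,t}(W_k,Y_k^{t-1})$ (that is, transmitter $k$ sees noiselessly and causally the past outputs of receiver $k$ only), and the error probability is $P_k=\mathbb{P}(g_k(Y_k^T)\ne W_k)$. Capacity. A rate tuple $(R_1,\dots,R_K)$ is achievable if there are $(T,M_1,\dots,M_K)$ feedback codes with $\log(M_k)/T\ge R_k-\epsilon_{k,T}$ and $P_k\le\epsilon_{k,T}$, where $\epsilon_{k,T}\to0$ as $T\to\infty$ for all $k$. The feedback capacity region is the set of all achievable tuples, and the feedback sum-capacity $\mathcal{C}^{\mathrm{FB}}_{\mathrm{sum},\mathrm{LD}}(K)$ is the maximum of $R_1+\dots+R_K$ over this region. The normalized symmetric feedback capacity per user is $$\mathcal{C}^{\mathrm{FB}}_{\mathrm{sym},\mathrm{LD}}(\alpha,K)=\frac{1}{K}\cdot\frac{\mathcal{C}^{\mathrm{FB}}_{\mathrm{sum},\mathrm{LD}}(K)}{n}.$$ *)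

theory Defs
  imports "HOL-Probability.Probability" "HOL-Probability.Product_PMF" "HOL-Library.Z2"
begin

text \<open>
  Users are numbered \<open>1, \<dots>, K\<close>.  Bit vectors are lists over the two-element field \<^typ>\<open>bit\<close>, with
  the top-most bit at the head of the list; addition on \<^typ>\<open>bit\<close> is addition modulo 2.
\<close>

definition next_user :: "nat \<Rightarrow> nat \<Rightarrow> nat" where
  "next_user K k = (if k = K then 1 else k + 1)"

definition xor_bits :: "bit list \<Rightarrow> bit list \<Rightarrow> bit list" where
  "xor_bits = map2 (+)"

type_synonym channel_input = "bit list"
type_synonym channel_output = "bit list \<times> bit list"

definition input_alphabet :: "nat \<Rightarrow> nat \<Rightarrow> channel_input set" where
  "input_alphabet n m = {x. length x = max n m}"

definition output_alphabet :: "nat \<Rightarrow> nat \<Rightarrow> channel_output set" where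
  "output_alphabet n m =
     {(u, v). length u = (if n \<ge> m then n - m else m - n) \<and> length v = min n m}"

text \<open>
  In both regimes the input has length \<open>max n m\<close>, so dropping \<open>|n - m|\<close> bits leaves the
  lower-most \<open>min n m\<close> bits.
\<close>

definition channel_output ::
    "nat \<Rightarrow> nat \<Rightarrow> nat \<Rightarrow> (nat \<Rightarrow> channel_input) \<Rightarrow> nat \<Rightarrow> channel_output" where
  "channel_output K n m X k =
     (let j = next_user K k in
      if n \<ge> m
      then (take (n - m) (X k), xor_bits (drop (n - m) (X k)) (take m (X j)))
      else (take (m - n) (X j), xor_bits (drop (m - n) (X j)) (take n (X k))))"

text \<open>
  \<open>f k t w ys\<close> is the input of transmitter \<open>k\<close> in channel use \<open>t \<ge> 1\<close>, given its message \<open>w\<close> and the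
  list \<open>ys\<close> of the \<open>t - 1\<close> past outputs of receiver \<open>k\<close>, oldest first.
\<close>

type_synonym encoder = "nat \<Rightarrow> nat \<Rightarrow> nat \<Rightarrow> channel_output list \<Rightarrow> channel_input"
type_synonym decoder = "nat \<Rightarrow> channel_output list \<Rightarrow> nat"

definition feedback_code ::
    "nat \<Rightarrow> nat \<Rightarrow> nat \<Rightarrow> nat \<Rightarrow> (nat \<Rightarrow> nat) \<Rightarrow> encoder \<Rightarrow> decoder \<Rightarrow> bool" where
  "feedback_code K n m T M f g \<longleftrightarrow>
     (\<forall>k\<in>{1..K}. M k \<ge> 1) \<and>
     (\<forall>k\<in>{1..K}. \<forall>t\<in>{1..T}. \<forall>w\<in>{1..M k}. \<forall>ys\<in>lists (output_alphabet n m).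
        length ys = t - 1 \<longrightarrow> f k t w ys \<in> input_alphabet n m) \<and>
     (\<forall>k\<in>{1..K}. \<forall>ys\<in>lists (output_alphabet n m). length ys = T \<longrightarrow> g k ys \<in> {1..M k})"

text \<open>
  \<open>received K n m f w t k\<close> is the sequence of the first \<open>t\<close> outputs of receiver \<open>k\<close> when the
  messages are \<open>w 1, \<dots>, w K\<close>.
\<close>

primrec received ::
    "nat \<Rightarrow> nat \<Rightarrow> nat \<Rightarrow> encoder \<Rightarrow> (nat \<Rightarrow> nat) \<Rightarrow> nat \<Rightarrow> nat \<Rightarrow> channel_output list" where
  "received K n m f w 0 = (\<lambda>k. [])"
| "received K n m f w (Suc t) =
     (\<lambda>k. received K n m f w t k @
        [channel_output K n m (\<lambda>j. f j (Suc t) (w j) (received K n m f w t j)) k])"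

definition message_pmf :: "nat \<Rightarrow> (nat \<Rightarrow> nat) \<Rightarrow> (nat \<Rightarrow> nat) pmf" where
  "message_pmf K M = Pi_pmf {1..K} 0 (\<lambda>k. pmf_of_set {1..M k})"

definition error_prob ::
    "nat \<Rightarrow> nat \<Rightarrow> nat \<Rightarrow> nat \<Rightarrow> (nat \<Rightarrow> nat) \<Rightarrow> encoder \<Rightarrow> decoder \<Rightarrow> nat \<Rightarrow> real" where
  "error_prob K n m T M f g k =
     measure_pmf.prob (message_pmf K M) {w. g k (received K n m f w T k) \<noteq> w k}"

definition achievable :: "nat \<Rightarrow> nat \<Rightarrow> nat \<Rightarrow> (nat \<Rightarrow> real) \<Rightarrow> bool" where
  "achievable K n m R \<longleftrightarrow>
     (\<exists>\<epsilon> :: nat \<Rightarrow> nat \<Rightarrow> real.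
        (\<forall>k\<in>{1..K}. \<epsilon> k \<longlonglongrightarrow> 0) \<and>
        (\<forall>T\<ge>1. \<exists>M f g. feedback_code K n m T M f g \<and>
           (\<forall>k\<in>{1..K}. log 2 (real (M k)) / real T \<ge> R k - \<epsilon> k T \<and>
                        error_prob K n m T M f g k \<le> \<epsilon> k T)))"

definition fb_capacity_region :: "nat \<Rightarrow> nat \<Rightarrow> nat \<Rightarrow> (nat \<Rightarrow> real) set" where
  "fb_capacity_region K n m = {R \<in> {1..K} \<rightarrow>\<^sub>E {0..}. achievable K n m R}"

definition fb_sum_capacity :: "nat \<Rightarrow> nat \<Rightarrow> nat \<Rightarrow> real" where
  "fb_sum_capacity K n m =
     (GREATEST s. \<exists>R\<in>fb_capacity_region K n m. s = (\<Sum>k=1..K. R k))"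

definition fb_sym_capacity :: "nat \<Rightarrow> nat \<Rightarrow> nat \<Rightarrow> real" where
  "fb_sym_capacity K n m = 1 / real K * (fb_sum_capacity K n m / real n)"

end

theory Submission
  imports Defs
begin

text \<open>
  Converse.  Let \<open>G\<close> be the set of message tuples that all receivers decode correctly.  On \<open>G\<close> the
  messages can be reconstructed from few output bits.  A receiver whose output is revealed yields its
  message, hence its input, hence the interference.  For \<open>m \<le> n\<close> this gives the top \<open>m\<close> bits of the
  next user, so only \<open>max (n - m) m\<close> new bits per channel use are needed to reveal the output of that
  user; going once around the ring \<open>K, 1, 2, \<dots>, K - 1\<close> bounds \<open>card G\<close>, and so the sum rate, without
  any entropy computation.  For \<open>n < m\<close> the ring is traversed as \<open>K, K - 1, \<dots>, 1\<close>.  Stopping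
  after two neighbouring users, with all other messages given, bounds the sum of two rates.

  Achievability.  For \<open>\<alpha> \<le> 2/3\<close> and \<open>\<alpha> \<ge> 2\<close> a block has \<open>K\<close> channel uses, and a part of the input is
  a relay: each transmitter repeats there what it learnt, through feedback, about the relay bits of the
  next user.  After \<open>K\<close> uses the relay bits have travelled around the ring, so that the interference
  that they caused is known, or (for \<open>\<alpha> \<ge> 2\<close>) they have reached their own receiver.  For
  \<open>2/3 \<le> \<alpha> \<le> 2\<close> two uses without feedback suffice: the top \<open>m\<close> levels are cut into layers of height
  \<open>\<bar>n - m\<bar>\<close>, and every other layer is left empty for the interference.
\<close>

section \<open>Counting decodable messages\<close>

text \<open>Rewriting addition to xor would disable the cancellation laws.\<close>

declare add_bit_eq_xor [simp del]

lemma next_user_in: "k \<in> {1..K} \<Longrightarrow> next_user K k \<in> {1..K}"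
  by (auto simp: next_user_def)

lemma next_user_neq: "K \<ge> 2 \<Longrightarrow> k \<in> {1..K} \<Longrightarrow> next_user K k \<noteq> k"
  by (auto simp: next_user_def)

lemma next_user_inj: "inj_on (next_user K) {1..K}"
  by (auto simp: next_user_def inj_on_def)

lemma bij_betw_next_user: "bij_betw (next_user K) {1..K} {1..K}"
proof -
  have "next_user K ` {1..K} \<subseteq> {1..K}"
    using next_user_in by blast
  then show ?thesis
    using endo_inj_surj[of "{1..K}" "next_user K"] next_user_inj by (simp add: bij_betw_def)
qed

section \<open>The channel, bit by bit\<close>

definition output_bit :: "channel_output \<Rightarrow> nat \<Rightarrow> bit" where
  "output_bit y p = (fst y @ snd y) ! p"

text \<open>Position \<open>p\<close> runs through the concatenation of both output parts. In either
  regime the output is then one signal plus the other one shifted down. Inputs are functions, so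
  that schemes can be given by formulas.\<close>

definition channel_bit :: "nat \<Rightarrow> nat \<Rightarrow> (nat \<Rightarrow> bit) \<Rightarrow> (nat \<Rightarrow> bit) \<Rightarrow> nat \<Rightarrow> bit" where
  "channel_bit n m a b p =
     (if n \<ge> m then a p + (if p \<ge> n - m then b (p - (n - m)) else 0)
      else b p + (if p \<ge> m - n then a (p - (m - n)) else 0))"

lemma output_bit_channel_output:
  assumes "length (X k) = max n m" "length (X (next_user K k)) = max n m" "p < max n m"
  shows "output_bit (channel_output K n m X k) p =
    channel_bit n m ((!) (X k)) ((!) (X (next_user K k))) p"
  using assms
  by (auto simp: output_bit_def channel_output_def channel_bit_def Let_def xor_bits_def
      nth_append max_def split: if_splits)

lemma channel_output_in_alphabet:
  assumes "length (X k) = max n m" "length (X (next_user K k)) = max n m"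
  shows "channel_output K n m X k \<in> output_alphabet n m"
  using assms by (auto simp: channel_output_def output_alphabet_def Let_def xor_bits_def)

lemma output_eqI:
  assumes "y \<in> output_alphabet n m" "y' \<in> output_alphabet n m"
    and "\<And>p. p < max n m \<Longrightarrow> output_bit y p = output_bit y' p"
  shows "y = y'"
proof -
  have "length (fst y @ snd y) = max n m" "length (fst y' @ snd y') = max n m"
    "length (fst y) = length (fst y')"
    using assms(1,2) by (auto simp: output_alphabet_def)
  moreover from this have "fst y @ snd y = fst y' @ snd y'"
    using assms(3) unfolding output_bit_def by (intro nth_equalityI) simp_all
  ultimately show ?thesis
    by (simp add: prod_eq_iff)
qed

section \<open>Runs of a code and the union bound\<close>

definition input_at :: "nat \<Rightarrow> nat \<Rightarrow> nat \<Rightarrow> encoder \<Rightarrow> (nat \<Rightarrow> nat) \<Rightarrow> nat \<Rightarrow> nat \<Rightarrow> channel_input" where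
  "input_at K n m f w t k = f k (Suc t) (w k) (received K n m f w t k)"

definition output_at :: "nat \<Rightarrow> nat \<Rightarrow> nat \<Rightarrow> encoder \<Rightarrow> (nat \<Rightarrow> nat) \<Rightarrow> nat \<Rightarrow> nat \<Rightarrow> channel_output" where
  "output_at K n m f w t k = channel_output K n m (input_at K n m f w t) k"

lemma received_eq_map: "received K n m f w t k = map (\<lambda>s. output_at K n m f w s k) [0..<t]"
  by (induction t arbitrary: k) (simp_all add: output_at_def input_at_def[abs_def])

text \<open>The default 0 outside the users is the one in \<open>message_pmf\<close>, which is thus
  uniform on this finite set if every \<open>M k\<close> is positive.\<close>

definition messages :: "nat \<Rightarrow> (nat \<Rightarrow> nat) \<Rightarrow> (nat \<Rightarrow> nat) set" where
  "messages K M = PiE_dflt {1..K} 0 (\<lambda>k. {1..M k})"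

definition decoded_messages ::
    "nat \<Rightarrow> nat \<Rightarrow> nat \<Rightarrow> nat \<Rightarrow> (nat \<Rightarrow> nat) \<Rightarrow> encoder \<Rightarrow> decoder \<Rightarrow> (nat \<Rightarrow> nat) set" where
  "decoded_messages K n m T M f g =
     {w \<in> messages K M. \<forall>k\<in>{1..K}. g k (received K n m f w T k) = w k}"

lemma message_pmf_eq:
  assumes "\<And>k. k \<in> {1..K} \<Longrightarrow> M k \<ge> 1"
  shows "message_pmf K M = pmf_of_set (messages K M)"
  unfolding message_pmf_def messages_def
  by (rule Pi_pmf_of_set) (use assms in fastforce)+

lemma finite_messages: "finite (messages K M)"
  unfolding messages_def by (rule finite_PiE_dflt) auto

lemma card_messages: "card (messages K M) = (\<Prod>k\<in>{1..K}. M k)"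
  unfolding messages_def by (subst card_PiE_dflt) auto

lemma messages_nonempty:
  assumes "\<And>k. k \<in> {1..K} \<Longrightarrow> M k \<ge> 1"
  shows "messages K M \<noteq> {}"
proof -
  have "card (messages K M) \<noteq> 0"
    using assms by (fastforce simp: card_messages)
  then show ?thesis by auto
qed

text \<open>A code constrains its encoders only on genuine output words, so the length at time
  \<open>t\<close> depends on all earlier inputs of \<open>k\<close> and its successor; hence the
  strong induction.\<close>

lemma inputs_length:
  assumes code: "feedback_code K n m T M f g" and w: "w \<in> messages K M" and "t < T"
  shows "k \<in> {1..K} \<Longrightarrow> length (input_at K n m f w t k) = max n m"
  using \<open>t < T\<close>
proof (induction t arbitrary: k rule: less_induct)
  case (less t)
  have "output_at K n m f w s k \<in> output_alphabet n m" if "s < t" for s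
    unfolding output_at_def
    using less that next_user_in[OF less.prems(1)] by (intro channel_output_in_alphabet) auto
  then have "received K n m f w t k \<in> lists (output_alphabet n m)"
    by (auto simp: received_eq_map)
  moreover have "w k \<in> {1..M k}"
    using w less.prems(1) by (auto simp: messages_def PiE_dflt_def)
  ultimately have "f k (Suc t) (w k) (received K n m f w t k) \<in> input_alphabet n m"
    using code less.prems unfolding feedback_code_def
    by (auto simp: received_eq_map)
  then show ?case by (simp add: input_at_def input_alphabet_def)
qed

lemma output_at_in_alphabet:
  assumes "feedback_code K n m T M f g" and "w \<in> messages K M" and "t < T" "k \<in> {1..K}"
  shows "output_at K n m f w t k \<in> output_alphabet n m"
  unfolding output_at_def
  using inputs_length[OF assms(1-3)] next_user_in[OF assms(4)] assms(4)
  by (intro channel_output_in_alphabet) auto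

lemma output_bit_output_at:
  assumes "feedback_code K n m T M f g" and "w \<in> messages K M" and "t < T" "k \<in> {1..K}" "p < max n m"
  shows "output_bit (output_at K n m f w t k) p =
    channel_bit n m ((!) (input_at K n m f w t k)) ((!) (input_at K n m f w t (next_user K k))) p"
  unfolding output_at_def
  using inputs_length[OF assms(1-3)] next_user_in[OF assms(4)] assms(4,5)
  by (intro output_bit_channel_output) auto

text \<open>Union bound: a tuple outside the decoded set is misdecoded by some receiver, and under
  the uniform distribution error probabilities are ratios of cardinalities.\<close>

lemma sum_error_prob_ge:
  assumes code: "feedback_code K n m T M f g"
  shows "(1 - (\<Sum>k\<in>{1..K}. error_prob K n m T M f g k)) * (\<Prod>k\<in>{1..K}. real (M k))
    \<le> real (card (decoded_messages K n m T M f g))"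
proof -
  have M: "\<And>k. k \<in> {1..K} \<Longrightarrow> M k \<ge> 1"
    using code by (auto simp: feedback_code_def)
  let ?W = "messages K M" and ?G = "decoded_messages K n m T M f g"
  define bad where "bad k = {w. g k (received K n m f w T k) \<noteq> w k}" for k
  have pmf: "message_pmf K M = pmf_of_set ?W"
    using M by (rule message_pmf_eq)
  have ne: "?W \<noteq> {}"
    using M by (rule messages_nonempty)
  have err: "error_prob K n m T M f g k = card (?W \<inter> bad k) / card ?W" for k
    unfolding error_prob_def pmf bad_def
    by (rule measure_pmf_of_set[OF ne finite_messages])
  have "?W = ?G \<union> (\<Union>k\<in>{1..K}. ?W \<inter> bad k)"
    by (auto simp: decoded_messages_def bad_def)
  then have "card ?W \<le> card ?G + card (\<Union>k\<in>{1..K}. ?W \<inter> bad k)"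
    using card_Un_le[of ?G "\<Union>k\<in>{1..K}. ?W \<inter> bad k"] by (rule ssubst)
  also have "card (\<Union>k\<in>{1..K}. ?W \<inter> bad k) \<le> (\<Sum>k\<in>{1..K}. card (?W \<inter> bad k))"
    by (rule card_UN_le) auto
  finally have "real (card ?W) \<le> real (card ?G + (\<Sum>k\<in>{1..K}. card (?W \<inter> bad k)))"
    by (rule of_nat_mono) simp
  then have "real (card ?W) \<le> card ?G + (\<Sum>k\<in>{1..K}. real (card (?W \<inter> bad k)))"
    by (simp only: of_nat_add of_nat_sum)
  moreover have "(\<Sum>k\<in>{1..K}. error_prob K n m T M f g k) * real (card ?W)
      = (\<Sum>k\<in>{1..K}. real (card (?W \<inter> bad k)))"
    using finite_messages[of K M] ne by (simp add: err sum_distrib_right)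
  moreover have "(\<Prod>k\<in>{1..K}. real (M k)) = real (card ?W)"
    by (simp add: card_messages)
  ultimately show ?thesis
    by (simp only: left_diff_distrib)
qed

section \<open>From reconstruction to a rate bound\<close>

lemma UNIV_bit: "(UNIV :: bit set) = {0, 1}"
  using bit_not_zero_iff by blast

lemma card_bit_functions: "finite D \<Longrightarrow> card (D \<rightarrow>\<^sub>E (UNIV :: bit set)) = 2 ^ card D"
  by (subst card_PiE) (simp_all add: UNIV_bit numeral_2_eq_2)

lemma finite_bit_functions: "finite D \<Longrightarrow> finite (D \<rightarrow>\<^sub>E (UNIV :: bit set))"
  by (rule finite_PiE) (simp_all only: UNIV_bit finite.intros)

text \<open>Reconstruction is phrased as injectivity. The messages outside \<open>S\<close> come for
  free, and the slots in \<open>D\<close> (receiver, time, position) are the revealed output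
  bits.\<close>

definition slots_determine ::
    "nat \<Rightarrow> nat \<Rightarrow> nat \<Rightarrow> nat \<Rightarrow> encoder \<Rightarrow> (nat \<Rightarrow> nat) set \<Rightarrow> nat set \<Rightarrow> (nat \<times> nat \<times> nat) set \<Rightarrow> bool" where
  "slots_determine K n m T f G S D \<longleftrightarrow>
     (\<forall>w\<in>G. \<forall>w'\<in>G.
        (\<forall>j\<in>{1..K} - S. w j = w' j) \<longrightarrow>
        (\<forall>(k, t, p)\<in>D. output_bit (output_at K n m f w t k) p =
           output_bit (output_at K n m f w' t k) p) \<longrightarrow>
        (\<forall>k\<in>S. w k = w' k))"

text \<open>A decoded tuple is encoded injectively by its messages outside \<open>S\<close> and its
  bits in \<open>D\<close>. In the comparison with the union bound the message counts outside
  \<open>S\<close> cancel.\<close>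

lemma counting_bound:
  assumes code: "feedback_code K n m T M f g" and S: "S \<subseteq> {1..K}" and D: "finite D"
    and det: "slots_determine K n m T f (decoded_messages K n m T M f g) S D"
  shows "(1 - (\<Sum>k\<in>{1..K}. error_prob K n m T M f g k)) * (\<Prod>k\<in>S. real (M k)) \<le> 2 ^ card D"
proof -
  let ?G = "decoded_messages K n m T M f g"
  have M: "\<And>k. k \<in> {1..K} \<Longrightarrow> M k \<ge> 1"
    using code by (auto simp: feedback_code_def)
  define \<Phi> where "\<Phi> w = (restrict w ({1..K} - S),
      restrict (\<lambda>(k, t, p). output_bit (output_at K n m f w t k) p) D)" for w
  let ?B = "PiE ({1..K} - S) (\<lambda>k. {1..M k}) \<times> (D \<rightarrow>\<^sub>E (UNIV :: bit set))"
  have "inj_on \<Phi> ?G"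
  proof (rule inj_onI)
    fix w w' assume w: "w \<in> ?G" "w' \<in> ?G" and eq: "\<Phi> w = \<Phi> w'"
    have 1: "w j = w' j" if "j \<in> {1..K} - S" for j
      using eq that unfolding \<Phi>_def prod.inject by (metis restrict_apply')
    have "output_bit (output_at K n m f w t k) p = output_bit (output_at K n m f w' t k) p"
      if "(k, t, p) \<in> D" for k t p
      using eq that unfolding \<Phi>_def prod.inject by (auto dest!: fun_cong[of _ _ "(k, t, p)"])
    with 1 have "\<forall>k\<in>S. w k = w' k"
      using det w unfolding slots_determine_def by blast
    with 1 have "\<And>j. j \<in> {1..K} \<Longrightarrow> w j = w' j" by blast
    then show "w = w'"
      using w by (auto simp: decoded_messages_def messages_def PiE_dflt_def fun_eq_iff)
        (metis atLeastAtMost_iff)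
  qed
  moreover have "\<Phi> ` ?G \<subseteq> ?B"
    unfolding \<Phi>_def decoded_messages_def messages_def PiE_dflt_def
    by (intro image_subsetI SigmaI restrict_PiE_iff[THEN iffD2]) auto
  moreover have "finite ?B"
    using D by (intro finite_cartesian_product finite_bit_functions finite_PiE) auto
  ultimately have "card ?G \<le> card ?B"
    by (metis card_image card_mono)
  also have "card ?B = (\<Prod>k\<in>{1..K} - S. M k) * 2 ^ card D"
    unfolding card_cartesian_product card_bit_functions[OF D] by (subst card_PiE) simp_all
  finally have "real (card ?G) \<le> real ((\<Prod>k\<in>{1..K} - S. M k) * 2 ^ card D)"
    by (rule of_nat_mono)
  then have "real (card ?G) \<le> (\<Prod>k\<in>{1..K} - S. real (M k)) * 2 ^ card D"
    by (simp only: of_nat_mult of_nat_prod of_nat_power of_nat_numeral)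
  with sum_error_prob_ge[OF code]
  have "(1 - (\<Sum>k\<in>{1..K}. error_prob K n m T M f g k)) * (\<Prod>k\<in>{1..K}. real (M k))
    \<le> (\<Prod>k\<in>{1..K} - S. real (M k)) * 2 ^ card D"
    by (rule order.trans)
  also have "(\<Prod>k\<in>{1..K}. real (M k)) = (\<Prod>k\<in>{1..K} - S. real (M k)) * (\<Prod>k\<in>S. real (M k))"
    using S by (intro prod.subset_diff) auto
  finally show ?thesis
    using prod_pos[of "{1..K} - S" "\<lambda>k. real (M k)"] M
    by (simp add: mult.left_commute Suc_le_eq)
qed

lemma log_prod_eq:
  fixes f :: "'a \<Rightarrow> real"
  assumes "finite I" "\<And>i. i \<in> I \<Longrightarrow> f i \<noteq> 0"
  shows "log b (\<Prod>i\<in>I. f i) = (\<Sum>i\<in>I. log b (f i))"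
  using ln_prod[OF assms] by (simp add: log_def sum_divide_distrib)

text \<open>Once the error probabilities sum to at most 1/2, the message counts over
  \<open>S\<close> have product at most \<open>2 ^ (T * B + 1)\<close>; the extra bit vanishes on
  division by \<open>T\<close>.\<close>

lemma sum_rate_bound:
  assumes ach: "achievable K n m R" and S: "S \<subseteq> {1..K}"
    and D: "\<And>T. finite (D T)" "\<And>T. card (D T) \<le> T * B"
    and det: "\<And>T M f g. feedback_code K n m T M f g \<Longrightarrow>
      slots_determine K n m T f (decoded_messages K n m T M f g) S (D T)"
  shows "(\<Sum>k\<in>S. R k) \<le> real B"
proof -
  obtain \<epsilon> where lim: "\<And>k. k \<in> {1..K} \<Longrightarrow> \<epsilon> k \<longlonglongrightarrow> 0"
    and codes: "\<And>T. T \<ge> 1 \<Longrightarrow> \<exists>M f g. feedback_code K n m T M f g \<and>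
           (\<forall>k\<in>{1..K}. log 2 (real (M k)) / real T \<ge> R k - \<epsilon> k T \<and>
                        error_prob K n m T M f g k \<le> \<epsilon> k T)"
    using ach unfolding achievable_def by blast
  have limK: "(\<lambda>T. \<Sum>k\<in>{1..K}. \<epsilon> k T) \<longlonglongrightarrow> 0"
    using lim by (intro tendsto_null_sum) auto
  have limS: "(\<lambda>T. \<Sum>k\<in>S. \<epsilon> k T) \<longlonglongrightarrow> 0"
    using lim S by (intro tendsto_null_sum) auto
  have "eventually (\<lambda>T. (\<Sum>k\<in>{1..K}. \<epsilon> k T) < 1/2) sequentially"
    using limK by (rule order_tendstoD) simp
  then have ev: "eventually (\<lambda>T. (\<Sum>k\<in>S. R k) \<le> real B + 1 / real T + (\<Sum>k\<in>S. \<epsilon> k T)) sequentially"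
    using eventually_ge_at_top[of 1]
  proof eventually_elim
    case (elim T)
    obtain M f g where code: "feedback_code K n m T M f g"
      and rate: "\<And>k. k \<in> {1..K} \<Longrightarrow> log 2 (real (M k)) / real T \<ge> R k - \<epsilon> k T"
      and err: "\<And>k. k \<in> {1..K} \<Longrightarrow> error_prob K n m T M f g k \<le> \<epsilon> k T"
      using codes[OF elim(2)] by blast
    have M: "M k \<ge> 1" if "k \<in> S" for k
      using code S that by (auto simp: feedback_code_def)
    have P: "(\<Prod>k\<in>S. real (M k)) > 0"
      using M by (intro prod_pos) force
    have "(\<Sum>k\<in>{1..K}. error_prob K n m T M f g k) \<le> 1/2"
      using elim(1) sum_mono[OF err, of "{1..K}" "\<lambda>k. k"] by linarith
    then have "(1/2) * (\<Prod>k\<in>S. real (M k))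
      \<le> (1 - (\<Sum>k\<in>{1..K}. error_prob K n m T M f g k)) * (\<Prod>k\<in>S. real (M k))"
      using P by (intro mult_right_mono) auto
    also have "\<dots> \<le> 2 ^ card (D T)"
      by (rule counting_bound[OF code S D(1) det[OF code]])
    also have "\<dots> \<le> 2 ^ (T * B)"
      using D(2) by (intro power_increasing) auto
    finally have "(\<Prod>k\<in>S. real (M k)) \<le> 2 ^ (T * B + 1)" by simp
    then have "log 2 (\<Prod>k\<in>S. real (M k)) \<le> log 2 (2 ^ (T * B + 1))"
      using P by simp
    also have "\<dots> = real T * real B + 1"
      by (subst log_nat_power) auto
    also have "log 2 (\<Prod>k\<in>S. real (M k)) = (\<Sum>k\<in>S. log 2 (real (M k)))"
      using M by (intro log_prod_eq finite_subset[OF S]) fastforce+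
    finally have "(\<Sum>k\<in>S. log 2 (real (M k))) \<le> real T * real B + 1" .
    then have "(\<Sum>k\<in>S. log 2 (real (M k)) / real T) \<le> real B + 1 / real T"
      using elim(2) by (simp add: field_simps flip: sum_divide_distrib)
    moreover have "(\<Sum>k\<in>S. R k - \<epsilon> k T) \<le> (\<Sum>k\<in>S. log 2 (real (M k)) / real T)"
      using rate S by (intro sum_mono) auto
    ultimately show ?case
      by (simp add: sum_subtractf)
  qed
  have "(\<lambda>T. real B + 1 / real T + (\<Sum>k\<in>S. \<epsilon> k T)) \<longlonglongrightarrow> real B + 0 + 0"
    by (intro tendsto_add tendsto_const limS lim_1_over_n)
  then show ?thesis
    using ev tendsto_lowerbound[OF _ ev] by simp
qed

section \<open>Upper bounds on the sum rate\<close>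

text \<open>That two decoded tuples agree in a quantity stands for this quantity being computable
  from the revealed bits.\<close>

locale decoded_pair =
  fixes K n m T :: nat and M :: "nat \<Rightarrow> nat" and f :: encoder and g :: decoder
    and w w' :: "nat \<Rightarrow> nat"
  assumes code: "feedback_code K n m T M f g"
    and w: "w \<in> decoded_messages K n m T M f g"
    and w': "w' \<in> decoded_messages K n m T M f g"
begin

abbreviation same_in :: "nat \<Rightarrow> nat \<Rightarrow> nat \<Rightarrow> bool" where
  "same_in t k p \<equiv> input_at K n m f w t k ! p = input_at K n m f w' t k ! p"

abbreviation same_out :: "nat \<Rightarrow> nat \<Rightarrow> nat \<Rightarrow> bool" where
  "same_out t k p \<equiv> output_bit (output_at K n m f w t k) p = output_bit (output_at K n m f w' t k) p"

abbreviation known :: "nat \<Rightarrow> bool" where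
  "known k \<equiv> \<forall>t<T. \<forall>p<max n m. same_out t k p"

lemma messages: "w \<in> messages K M" "w' \<in> messages K M"
  using w w' by (auto simp: decoded_messages_def)

lemma same_received:
  assumes "k \<in> {1..K}" "t \<le> T" "\<And>s p. s < t \<Longrightarrow> p < max n m \<Longrightarrow> same_out s k p"
  shows "received K n m f w t k = received K n m f w' t k"
  unfolding received_eq_map
proof (rule map_cong[OF refl])
  fix s assume "s \<in> set [0..<t]"
  then show "output_at K n m f w s k = output_at K n m f w' s k"
    using assms output_at_in_alphabet[OF code] messages by (intro output_eqI[where n=n and m=m]) auto
qed

text \<open>This is where correct decoding enters.\<close>

lemma known_message:
  assumes "k \<in> {1..K}" "known k"
  shows "w k = w' k"
proof -
  have "received K n m f w T k = received K n m f w' T k"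
    using assms by (intro same_received) auto
  then show ?thesis
    using w w' assms(1) unfolding decoded_messages_def mem_Collect_eq by metis
qed

lemma same_input:
  assumes "k \<in> {1..K}" "t < T" "w k = w' k" "\<And>s p. s < t \<Longrightarrow> p < max n m \<Longrightarrow> same_out s k p"
  shows "same_in t k p"
  using same_received[of k t] assms by (simp add: input_at_def)

lemma known_input:
  assumes "k \<in> {1..K}" "known k" "t < T"
  shows "same_in t k p"
  using assms known_message[OF assms(1,2)] by (intro same_input) auto

lemmas output_bits = output_bit_output_at[OF code messages(1)] output_bit_output_at[OF code messages(2)]

lemma same_outI_le:
  assumes "m \<le> n" "t < T" "k \<in> {1..K}" "p < n" "same_in t k p"
    "p \<ge> n - m \<Longrightarrow> same_in t (next_user K k) (p - (n - m))"
  shows "same_out t k p"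
  using assms by (simp add: output_bits channel_bit_def)

text \<open>The own input cancels from the output, which uncovers the top \<open>m\<close> bits of
  the next user.\<close>

lemma same_inI_le:
  assumes "m \<le> n" "t < T" "k \<in> {1..K}" "p < m" "same_in t k (p + (n - m))"
    "same_out t k (p + (n - m))"
  shows "same_in t (next_user K k) p"
proof -
  have shift: "channel_bit n m a b (p + (n - m)) = a (p + (n - m)) + b p" for a b
    unfolding channel_bit_def by (simp only: assms(1) if_True le_add2 add_diff_cancel_right')
  have "p + (n - m) < max n m"
    using assms by linarith
  note bits = output_bits[OF assms(2,3) this]
  show ?thesis
    using assms(5,6) by (simp only: bits shift add_left_cancel)
qed

lemma same_outI_gt:
  assumes "n < m" "t < T" "k \<in> {1..K}" "p < m" "same_in t (next_user K k) p"
    "p \<ge> m - n \<Longrightarrow> same_in t k (p - (m - n))"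
  shows "same_out t k p"
  using assms by (simp add: output_bits channel_bit_def)

text \<open>For \<open>n < m\<close> the output contains every input bit of the next user, so here
  its whole input can be uncovered.\<close>

lemma same_inI_gt:
  assumes "n < m" "t < T" "k \<in> {1..K}" "p < m" "same_out t k p"
    "p \<ge> m - n \<Longrightarrow> same_in t k (p - (m - n))"
  shows "same_in t (next_user K k) p"
  using assms by (simp add: output_bits channel_bit_def split: if_splits)

text \<open>A known user uncovers the top \<open>m\<close> bits of its successor. Those among the
  first \<open>n - m\<close> positions reach their receiver undisturbed and need not be revealed.
  User \<open>K - 1\<close> comes last: its interferer \<open>K\<close> is known too, which saves
  all of the first \<open>m\<close> positions.\<close>

lemma chain_determines_le:
  assumes K: "K \<ge> 2" and mn: "m \<le> n" and "known K"
    and mid: "\<And>k t p. k \<in> {1..K - 2} \<Longrightarrow> t < T \<Longrightarrow> p \<in> {min m (n - m)..<n} \<Longrightarrow> same_out t k p"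
    and last: "\<And>t p. t < T \<Longrightarrow> p \<in> {m..<n} \<Longrightarrow> same_out t (K - 1) p"
    and k: "k \<in> {1..K}"
  shows "w k = w' k"
proof -
  \<comment> \<open>The ring is entered at user \<open>K\<close>, whose successor is user 1.\<close>
  define u where "u i = (if i = 0 then K else i)" for i
  have u: "u i \<in> {1..K}" "next_user K (u i) = u (Suc i)" if "i < K" for i
    using that K by (auto simp: u_def next_user_def)
  have top: "same_in t (u (Suc i)) p" if "known (u i)" "i < K" "t < T" "p < m" for i t p
    using same_inI_le[OF mn \<open>t < T\<close> u(1)[OF \<open>i < K\<close>] \<open>p < m\<close>] known_input[OF u(1)[OF \<open>i < K\<close>]] that mn
    by (auto simp: u(2))
  have "known (u i)" if "i \<le> K - 2" for i
    using that
  proof (induction i)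
    case 0
    then show ?case using \<open>known K\<close> by (simp add: u_def)
  next
    case (Suc i)
    then have prev: "known (u i)" and i: "i < K" "Suc i < K" "Suc i \<in> {1..K - 2}"
      using K by auto
    show ?case
    proof (intro allI impI)
      fix t p assume t: "t < T" and p: "p < max n m"
      show "same_out t (u (Suc i)) p"
      proof (cases "p < min m (n - m)")
        case True
        then show ?thesis
          using top[OF prev i(1) t] p mn by (intro same_outI_le[OF mn t u(1)[OF i(2)]]) auto
      next
        case False
        then show ?thesis
          using mid[OF i(3) t, of p] p mn by (auto simp: u_def min_def split: if_splits)
      qed
    qed
  qed note mids = this
  have "known (K - 1)"
  proof (intro allI impI)
    fix t p assume t: "t < T" and p: "p < max n m"
    have K1: "K - 1 \<in> {1..K}" "next_user K (K - 1) = K" "u (Suc (K - 2)) = K - 1"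
      using K by (auto simp: next_user_def u_def)
    show "same_out t (K - 1) p"
    proof (cases "p < m")
      case True
      have "same_in t (K - 1) p"
        using top[OF mids[OF order.refl] _ t True] K K1(3) by simp
      moreover have "same_in t K p" for p
        using known_input[OF _ \<open>known K\<close> t] K by simp
      ultimately show ?thesis
        using p mn by (intro same_outI_le[OF mn t K1(1)]) (auto simp: K1(2) simp del: One_nat_def)
    next
      case False
      then show ?thesis using last[OF t, of p] p mn by simp
    qed
  qed
  moreover have "known k" if "k \<in> {1..K - 2}"
    using mids[of k] that by (auto simp: u_def)
  moreover have "k = K \<or> k = K - 1 \<or> k \<in> {1..K - 2}"
    using k by auto
  ultimately have "known k"
    using \<open>known K\<close> by auto
  then show ?thesis
    by (rule known_message[OF k])
qed

text \<open>Going backwards, the top \<open>m - n\<close> output bits of each user come from its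
  successor alone, which is already known; the \<open>n\<close> lower ones are revealed.\<close>

lemma chain_determines_gt:
  assumes K: "K \<ge> 2" and mn: "n < m" and "known K"
    and mid: "\<And>k t p. k \<in> {2..K - 1} \<Longrightarrow> t < T \<Longrightarrow> p \<in> {m - n..<m} \<Longrightarrow> same_out t k p"
    and k: "k \<in> {1..K}"
  shows "w k = w' k"
proof -
  have top: "same_in t (next_user K k) p" if "known k" "k \<in> {1..K}" "t < T" "p < m" for k t p
    using same_inI_gt[OF mn \<open>t < T\<close> \<open>k \<in> {1..K}\<close> \<open>p < m\<close>] known_input[OF \<open>k \<in> {1..K}\<close>] that mn
    by auto
  have mids: "known (K - i)" if "i \<le> K - 2" for i
    using that
  proof (induction i)
    case 0
    then show ?case using \<open>known K\<close> by simp
  next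
    case (Suc i)
    then have prev: "known (K - i)" and i: "K - i \<in> {1..K}" "K - Suc i \<in> {1..K}"
      "K - Suc i \<in> {2..K - 1}" "next_user K (K - Suc i) = K - i"
      using K by (auto simp: next_user_def)
    show ?case
    proof (intro allI impI)
      fix t p assume t: "t < T" and p: "p < max n m"
      show "same_out t (K - Suc i) p"
      proof (cases "p < m - n")
        case True
        then show ?thesis
          using known_input[OF i(1) prev t] mn
          by (intro same_outI_gt[OF mn t i(2)]) (auto simp: i(4))
      next
        case False
        then show ?thesis
          using mid[OF i(3) t, of p] p mn by simp
      qed
    qed
  qed
  \<comment> \<open>User 1 costs nothing: receiver \<open>K\<close> uncovers its input, and its
    interferer, user 2, is known.\<close>
  have "known 1"
  proof (intro allI impI)
    fix t p assume t: "t < T" and p: "p < max n m"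
    have "known 2"
      using mids[of "K - 2"] K by simp
    then have "same_in t 2 p" for p
      using known_input[of 2 t] t K by simp
    moreover have "same_in t 1 p" if "p < m" for p
      using top[OF \<open>known K\<close> _ t that] K by (simp add: next_user_def)
    ultimately show "same_out t 1 p"
      using p mn K by (intro same_outI_gt[OF mn t]) (auto simp: next_user_def numeral_2_eq_2)
  qed
  moreover have "known k" if "k \<in> {2..K}"
    using mids[of "K - k"] that by auto
  moreover have "k = 1 \<or> k \<in> {2..K}"
    using k by auto
  ultimately have "known k"
    by auto
  then show ?thesis
    by (rule known_message[OF k])
qed

text \<open>Receiver \<open>k\<close> yields its message and the top \<open>m\<close> bits of its
  successor. The interferer of that successor can be simulated, so only the successor's own bits
  from \<open>m\<close> on are missing.\<close>

lemma pair_determines: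
  assumes K: "K \<ge> 2" and k: "k \<in> {1..K}" and "known k"
    and rest: "\<And>t p. t < T \<Longrightarrow> p \<in> {m..<n} \<Longrightarrow> same_out t (next_user K k) p"
    and others: "\<And>j. j \<in> {1..K} - {k, next_user K k} \<Longrightarrow> w j = w' j"
  shows "w k = w' k" "w (next_user K k) = w' (next_user K k)"
proof -
  let ?j = "next_user K k"
  have j: "?j \<in> {1..K}" "?j \<noteq> k" "next_user K ?j \<in> {1..K}" "next_user K ?j \<noteq> ?j"
    using next_user_in next_user_neq K k by auto
  show wk: "w k = w' k"
    by (rule known_message[OF k \<open>known k\<close>])
  have top: "same_in t ?j p" if "t < T" "p < m" for t p
  proof (cases "m \<le> n")
    case True
    then show ?thesis
      using same_inI_le[OF True \<open>t < T\<close> k \<open>p < m\<close>] known_input[OF k \<open>known k\<close> \<open>t < T\<close>]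
        \<open>known k\<close> that by auto
  next
    case False
    then show ?thesis
      using same_inI_gt[OF _ \<open>t < T\<close> k \<open>p < m\<close>] known_input[OF k \<open>known k\<close> \<open>t < T\<close>]
        \<open>known k\<close> that by auto
  qed
  \<comment> \<open>Apart from \<open>?j\<close> itself only receiver \<open>k\<close> hears
    \<open>?j\<close>, and its output is known. All inputs other than that of \<open>?j\<close> can
    therefore be simulated forward in time from the messages.\<close>
  have others_in: "same_in t i p" if "t < T" "i \<in> {1..K} - {?j}" for t i p
    using that
  proof (induction t arbitrary: i p rule: less_induct)
    case (less t)
    have "w i = w' i"
      using others wk less.prems by blast
    moreover have "same_out s i p" if s: "s < t" and p: "p < max n m" for s p
    proof (cases "i = k")
      case True
      then show ?thesis using \<open>known k\<close> s p less.prems by auto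
    next
      case False
      then have "next_user K i \<in> {1..K} - {?j}"
        using next_user_in[of i K] less.prems(2) inj_on_eq_iff[OF next_user_inj, of i K k] k by blast
      then have ins: "same_in s i q" "same_in s (next_user K i) q" for q
        using less.IH[OF s order.strict_trans[OF s less.prems(1)]] less.prems(2) by blast+
      have sT: "s < T" and i: "i \<in> {1..K}"
        using s less.prems by auto
      show ?thesis
      proof (cases "m \<le> n")
        case True
        then show ?thesis
          using p ins by (intro same_outI_le[OF True sT i]) simp_all
      next
        case False
        then show ?thesis
          using p ins by (intro same_outI_gt[OF _ sT i]) simp_all
      qed
    qed
    ultimately show ?case
      using less.prems by (intro same_input) auto
  qed
  have "known ?j"
  proof (intro allI impI)
    fix t p assume t: "t < T" and p: "p < max n m"
    have next_in: "same_in t (next_user K ?j) p" for p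
      using others_in[OF t] j by blast
    consider "p \<in> {m..<n}" | "m \<le> n" "p < m" | "n < m" "p < m"
      using p by fastforce
    then show "same_out t ?j p"
    proof cases
      case 1
      then show ?thesis using rest t by blast
    next
      case 2
      then show ?thesis
        using top[OF t] next_in by (intro same_outI_le[OF _ t j(1)]) auto
    next
      case 3
      then show ?thesis
        using top[OF t] next_in by (intro same_outI_gt[OF _ t j(1)]) auto
    qed
  qed
  then show "w ?j = w' ?j"
    by (rule known_message[OF j(1)])
qed

end

section \<open>Slot counts for the converse bounds\<close>

lemma sum_rate_bound_le:
  assumes ach: "achievable K n m R" and K: "K \<ge> 2" and mn: "m \<le> n"
  shows "(\<Sum>k\<in>{1..K}. R k) \<le> real (n + (K - 2) * max (n - m) m + (n - m))"
proof (rule sum_rate_bound[OF ach order.refl])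
  \<comment> \<open>Per channel use, user \<open>K\<close> reveals \<open>n\<close> bits, each of
    the \<open>K - 2\<close> middle users \<open>n - min m (n - m) = max (n - m) m\<close>, and user
    \<open>K - 1\<close> only \<open>n - m\<close>.\<close>
  define D1 D2 D3 where "D1 T = {K} \<times> {..<T} \<times> {..<n}"
    and "D2 T = {1..K - 2} \<times> {..<T} \<times> {min m (n - m)..<n}"
    and "D3 T = {K - 1} \<times> {..<T} \<times> {m..<n}" for T :: nat
  define D where "D T = D1 T \<union> D2 T \<union> D3 T" for T
  show "finite (D T)" for T
    by (simp add: D_def D1_def D2_def D3_def)
  have "card (D T) \<le> card (D1 T) + card (D2 T) + card (D3 T)" for T
    unfolding D_def by (metis add_right_mono card_Un_le order.trans)
  moreover have "card (D1 T) + card (D2 T) + card (D3 T)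
      = T * (n + (K - 2) * max (n - m) m + (n - m))" for T
  proof -
    have "n - min m (n - m) = max (n - m) m"
      using mn by auto
    moreover have "card (D1 T) + card (D2 T) + card (D3 T)
        = T * n + (K - 2) * (T * (n - min m (n - m))) + T * (n - m)"
      by (simp add: D1_def D2_def D3_def)
    ultimately show ?thesis
      by (simp only: add_mult_distrib2 mult.left_commute)
  qed
  ultimately show "card (D T) \<le> T * (n + (K - 2) * max (n - m) m + (n - m))" for T
    by metis
  show "slots_determine K n m T f (decoded_messages K n m T M f g) {1..K} (D T)"
    if code: "feedback_code K n m T M f g" for T M f g
    unfolding slots_determine_def
  proof (intro ballI impI)
    fix w w' k assume ww: "w \<in> decoded_messages K n m T M f g" "w' \<in> decoded_messages K n m T M f g"
      and k: "k \<in> {1..K}"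
      and eq: "\<forall>(k, t, p)\<in>D T. output_bit (output_at K n m f w t k) p =
           output_bit (output_at K n m f w' t k) p"
    interpret decoded_pair K n m T M f g w w'
      by standard (use code ww in auto)
    show "w k = w' k"
      by (rule chain_determines_le[OF K mn _ _ _ k])
        (use eq mn in \<open>force simp: D_def D1_def D2_def D3_def\<close>)+
  qed
qed

lemma sum_rate_bound_gt:
  assumes ach: "achievable K n m R" and K: "K \<ge> 2" and mn: "n < m"
  shows "(\<Sum>k\<in>{1..K}. R k) \<le> real (m + (K - 2) * n)"
proof (rule sum_rate_bound[OF ach order.refl])
  define D1 D2 where "D1 T = {K} \<times> {..<T} \<times> {..<m}"
    and "D2 T = {2..K - 1} \<times> {..<T} \<times> {m - n..<m}" for T :: nat
  define D where "D T = D1 T \<union> D2 T" for T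
  show "finite (D T)" for T
    by (simp add: D_def D1_def D2_def)
  have "card (D T) \<le> card (D1 T) + card (D2 T)" for T
    unfolding D_def by (rule card_Un_le)
  moreover have "card (D1 T) + card (D2 T) = T * (m + (K - 2) * n)" for T
    using mn K by (simp add: D1_def D2_def algebra_simps numeral_2_eq_2)
  ultimately show "card (D T) \<le> T * (m + (K - 2) * n)" for T
    by metis
  show "slots_determine K n m T f (decoded_messages K n m T M f g) {1..K} (D T)"
    if code: "feedback_code K n m T M f g" for T M f g
    unfolding slots_determine_def
  proof (intro ballI impI)
    fix w w' k assume ww: "w \<in> decoded_messages K n m T M f g" "w' \<in> decoded_messages K n m T M f g"
      and k: "k \<in> {1..K}"
      and eq: "\<forall>(k, t, p)\<in>D T. output_bit (output_at K n m f w t k) p =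
           output_bit (output_at K n m f w' t k) p"
    interpret decoded_pair K n m T M f g w w'
      by standard (use code ww in auto)
    show "w k = w' k"
      by (rule chain_determines_gt[OF K mn _ _ k])
        (use eq mn in \<open>force simp: D_def D1_def D2_def\<close>)+
  qed
qed

lemma pair_rate_bound:
  assumes ach: "achievable K n m R" and K: "K \<ge> 2" and k: "k \<in> {1..K}"
  shows "R k + R (next_user K k) \<le> real (max n m + (n - m))"
proof -
  let ?j = "next_user K k"
  have j: "?j \<in> {1..K}" "?j \<noteq> k"
    using next_user_in next_user_neq K k by auto
  \<comment> \<open>For \<open>n \<le> m\<close> the range \<open>{m..<n}\<close> is empty and
    \<open>n - m\<close> is 0: the successor then costs nothing.\<close>
  define D where "D T = {k} \<times> {..<T} \<times> {..<max n m} \<union> {?j} \<times> {..<T} \<times> {m..<n}" for T :: nat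
  have "(\<Sum>i\<in>{k, ?j}. R i) \<le> real (max n m + (n - m))"
  proof (rule sum_rate_bound[OF ach])
    show "{k, ?j} \<subseteq> {1..K}"
      using k j by auto
    show "finite (D T)" for T
      by (simp add: D_def)
    have "card (D T) \<le> card ({k} \<times> {..<T} \<times> {..<max n m}) + card ({?j} \<times> {..<T} \<times> {m..<n})" for T
      unfolding D_def by (rule card_Un_le)
    then show "card (D T) \<le> T * (max n m + (n - m))" for T
      by (simp add: algebra_simps)
    show "slots_determine K n m T f (decoded_messages K n m T M f g) {k, ?j} (D T)"
      if code: "feedback_code K n m T M f g" for T M f g
      unfolding slots_determine_def
    proof (intro ballI impI)
      fix w w' i
      assume ww: "w \<in> decoded_messages K n m T M f g" "w' \<in> decoded_messages K n m T M f g"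
        and i: "i \<in> {k, ?j}" and others: "\<forall>j\<in>{1..K} - {k, ?j}. w j = w' j"
        and eq: "\<forall>(k, t, p)\<in>D T. output_bit (output_at K n m f w t k) p =
           output_bit (output_at K n m f w' t k) p"
      interpret decoded_pair K n m T M f g w w'
        by standard (use code ww in auto)
      have "known k" "\<And>t p. t < T \<Longrightarrow> p \<in> {m..<n} \<Longrightarrow> same_out t ?j p"
        using eq by (force simp: D_def)+
      then show "w i = w' i"
        using pair_determines[OF K k] others i by blast
    qed
  qed
  then show ?thesis
    using j by simp
qed

text \<open>Summing the pair bound around the ring counts every rate twice.\<close>

lemma sum_rate_bound_pairs:
  assumes ach: "achievable K n m R" and K: "K \<ge> 2"
  shows "(\<Sum>k\<in>{1..K}. R k) \<le> real K * real (max n m + (n - m)) / 2"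
proof -
  have "(\<Sum>k\<in>{1..K}. R (next_user K k)) = (\<Sum>k\<in>{1..K}. R k)"
    by (rule sum.reindex_bij_betw[OF bij_betw_next_user])
  then have "2 * (\<Sum>k\<in>{1..K}. R k) = (\<Sum>k\<in>{1..K}. R k + R (next_user K k))"
    by (simp add: sum.distrib)
  also have "\<dots> \<le> (\<Sum>k\<in>{1..K}. real (max n m + (n - m)))"
    by (intro sum_mono pair_rate_bound[OF ach K])
  finally show ?thesis by simp
qed

section \<open>Repeating a zero-error block scheme\<close>

text \<open>The decoder picks any message tuple that explains the received word; separation makes
  the choice irrelevant.\<close>

lemma separating_encoder_gives_code:
  assumes M: "\<And>k. k \<in> {1..K} \<Longrightarrow> M k \<ge> 1"
    and len: "\<And>k t w ys. length (f k t w ys) = max n m"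
    and sep: "\<And>w w' k. w \<in> messages K M \<Longrightarrow> w' \<in> messages K M \<Longrightarrow> k \<in> {1..K} \<Longrightarrow>
      received K n m f w T k = received K n m f w' T k \<Longrightarrow> w k = w' k"
  shows "\<exists>g. feedback_code K n m T M f g \<and> (\<forall>k\<in>{1..K}. error_prob K n m T M f g k = 0)"
proof -
  \<comment> \<open>The default 1 keeps the decoder in range on words that no tuple
    produces.\<close>
  define g where "g k ys = (if \<exists>w\<in>messages K M. received K n m f w T k = ys
    then (SOME w. w \<in> messages K M \<and> received K n m f w T k = ys) k else 1)" for k ys
  have msg: "w k \<in> {1..M k}" if "w \<in> messages K M" "k \<in> {1..K}" for w k
    using that by (auto simp: messages_def PiE_dflt_def)
  have some: "(SOME w. w \<in> messages K M \<and> received K n m f w T k = ys) \<in> messages K M \<and>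
      received K n m f (SOME w. w \<in> messages K M \<and> received K n m f w T k = ys) T k = ys"
    if "\<exists>w\<in>messages K M. received K n m f w T k = ys" for k ys
  proof -
    have "\<exists>w. w \<in> messages K M \<and> received K n m f w T k = ys"
      using that by blast
    then show ?thesis by (rule someI_ex)
  qed
  have "g k ys \<in> {1..M k}" if "k \<in> {1..K}" for k ys
  proof (cases "\<exists>w\<in>messages K M. received K n m f w T k = ys")
    case True
    then show ?thesis
      using msg[OF conjunct1[OF some[OF True]] that] by (simp add: g_def)
  next
    case False
    then show ?thesis
      using M[OF that] by (simp add: g_def)
  qed
  then have code: "feedback_code K n m T M f g"
    using M len by (simp add: feedback_code_def input_alphabet_def)
  have decode: "g k (received K n m f w T k) = w k" if "w \<in> messages K M" "k \<in> {1..K}" for w k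
  proof -
    have ex: "\<exists>w'\<in>messages K M. received K n m f w' T k = received K n m f w T k"
      using that by blast
    show ?thesis
      using sep[OF conjunct1[OF some[OF ex]] that conjunct2[OF some[OF ex]]] ex by (simp add: g_def)
  qed
  have pmf: "message_pmf K M = pmf_of_set (messages K M)"
    using M by (rule message_pmf_eq)
  have ne: "messages K M \<noteq> {}"
    using M by (rule messages_nonempty)
  have "error_prob K n m T M f g k = 0" if "k \<in> {1..K}" for k
    unfolding error_prob_def pmf measure_pmf_zero_iff set_pmf_of_set[OF ne finite_messages]
    using decode that by blast
  with code show ?thesis by blast
qed

text \<open>\<open>x\<close> describes the inputs as if the symbols \<open>c\<close> of all users
  were visible. \<open>causal\<close> says that the own symbol and own past outputs suffice to form
  them, \<open>separating\<close> that a block of outputs yields the own symbol.\<close>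

locale block_scheme =
  fixes K n m N :: nat and A :: "'a set"
    and x :: "(nat \<Rightarrow> 'a) \<Rightarrow> nat \<Rightarrow> nat \<Rightarrow> nat \<Rightarrow> bit"
  assumes N: "N \<ge> 1" and A: "finite A" "A \<noteq> {}"
    and causal: "\<And>c c' t k p. c \<in> {1..K} \<rightarrow> A \<Longrightarrow> c' \<in> {1..K} \<rightarrow> A \<Longrightarrow> k \<in> {1..K} \<Longrightarrow> t < N \<Longrightarrow>
      c k = c' k \<Longrightarrow>
      (\<And>s q. s < t \<Longrightarrow> q < max n m \<Longrightarrow> channel_bit n m (x c s k) (x c s (next_user K k)) q =
         channel_bit n m (x c' s k) (x c' s (next_user K k)) q) \<Longrightarrow>
      p < max n m \<Longrightarrow> x c t k p = x c' t k p"
    and separating: "\<And>c c' k. c \<in> {1..K} \<rightarrow> A \<Longrightarrow> c' \<in> {1..K} \<rightarrow> A \<Longrightarrow> k \<in> {1..K} \<Longrightarrow>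
      (\<And>t p. t < N \<Longrightarrow> p < max n m \<Longrightarrow> channel_bit n m (x c t k) (x c t (next_user K k)) p =
         channel_bit n m (x c' t k) (x c' t (next_user K k)) p) \<Longrightarrow> c k = c' k"
begin

definition X :: "(nat \<Rightarrow> 'a) \<Rightarrow> nat \<Rightarrow> nat \<Rightarrow> channel_input" where
  "X c t k = map (x c t k) [0..<max n m]"

definition Y :: "(nat \<Rightarrow> 'a) \<Rightarrow> nat \<Rightarrow> nat \<Rightarrow> channel_output" where
  "Y c t k = channel_output K n m (X c t) k"

lemma length_X [simp]: "length (X c t k) = max n m"
  by (simp add: X_def)

lemma output_bit_Y:
  assumes "p < max n m"
  shows "output_bit (Y c t k) p = channel_bit n m (x c t k) (x c t (next_user K k)) p"
proof -
  have "channel_bit n m ((!) (X c t k)) ((!) (X c t (next_user K k))) p =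
      channel_bit n m (x c t k) (x c t (next_user K k)) p"
    using assms by (auto simp: channel_bit_def X_def)
  then show ?thesis
    using assms by (simp add: Y_def output_bit_channel_output)
qed

text \<open>A transmitter does not see the other symbols, so it picks any assignment that explains
  its symbol and feedback. By causality its input does not depend on this choice.\<close>

definition block_encoder :: "nat \<Rightarrow> nat \<Rightarrow> 'a \<Rightarrow> channel_output list \<Rightarrow> channel_input" where
  "block_encoder k t a ys =
     X (SOME c. c \<in> {1..K} \<rightarrow> A \<and> c k = a \<and> map (\<lambda>s. Y c s k) [0..<t] = ys) t k"

lemma block_encoder:
  assumes c: "c \<in> {1..K} \<rightarrow> A" and k: "k \<in> {1..K}" and t: "t < N"
  shows "block_encoder k t (c k) (map (\<lambda>s. Y c s k) [0..<t]) = X c t k"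
proof -
  define c' where "c' = (SOME c'. c' \<in> {1..K} \<rightarrow> A \<and> c' k = c k \<and>
    map (\<lambda>s. Y c' s k) [0..<t] = map (\<lambda>s. Y c s k) [0..<t])"
  have "\<exists>c'. c' \<in> {1..K} \<rightarrow> A \<and> c' k = c k \<and>
    map (\<lambda>s. Y c' s k) [0..<t] = map (\<lambda>s. Y c s k) [0..<t]"
    using c by blast
  then have c': "c' \<in> {1..K} \<rightarrow> A \<and> c' k = c k \<and>
    map (\<lambda>s. Y c' s k) [0..<t] = map (\<lambda>s. Y c s k) [0..<t]"
    unfolding c'_def by (rule someI_ex)
  then have eq: "Y c' s k = Y c s k" if "s < t" for s
    using that by (auto simp: map_eq_conv)
  have "x c' t k p = x c t k p" if "p < max n m" for p
  proof (rule causal[OF _ c k t _ _ that])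
    show "c' \<in> {1..K} \<rightarrow> A" "c' k = c k"
      using c' by auto
    show "channel_bit n m (x c' s k) (x c' s (next_user K k)) q =
        channel_bit n m (x c s k) (x c s (next_user K k)) q" if "s < t" "q < max n m" for s q
      using output_bit_Y[OF that(2)] eq[OF that(1)] by metis
  qed
  then show ?thesis
    unfolding block_encoder_def c'_def[symmetric] by (simp add: X_def)
qed

lemma length_block_encoder: "length (block_encoder k t a ys) = max n m"
  by (simp add: block_encoder_def)

text \<open>Feedback from earlier blocks is dropped, which keeps blocks independent; after
  \<open>q\<close> blocks the transmitter sends zeros.\<close>

definition blocks_encoder :: "nat \<Rightarrow> (nat \<Rightarrow> 'a list) \<Rightarrow> encoder" where
  "blocks_encoder q \<phi> k t w ys =
     (let i = (t - 1) div N in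
      if i < q then block_encoder k ((t - 1) mod N) (\<phi> w ! i) (drop (i * N) ys)
      else replicate (max n m) 0)"

lemma blocks_encoder_Suc:
  "t div N < q \<Longrightarrow> blocks_encoder q \<phi> k (Suc t) w ys =
     block_encoder k (t mod N) (\<phi> w ! (t div N)) (drop (t div N * N) ys)"
  by (simp add: blocks_encoder_def Let_def)

text \<open>Induction on time: the feedback within the current block must itself stem from the
  intended inputs of \<open>k\<close> and its successor.\<close>

lemma input_at_blocks_encoder:
  assumes \<phi>: "\<And>k. k \<in> {1..K} \<Longrightarrow> length (\<phi> (w k)) = q \<and> set (\<phi> (w k)) \<subseteq> A"
    and k: "k \<in> {1..K}" and t: "t < q * N"
  shows "input_at K n m (blocks_encoder q \<phi>) w t k = X (\<lambda>j. \<phi> (w j) ! (t div N)) (t mod N) k"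
  using k t
proof (induction t arbitrary: k rule: less_induct)
  case (less t)
  define i where "i = t div N"
  define c where "c j = \<phi> (w j) ! i" for j
  have i: "i < q"
    using less.prems(2) N by (simp add: i_def less_mult_imp_div_less)
  have c: "c \<in> {1..K} \<rightarrow> A"
  proof (rule Pi_I)
    fix j assume "j \<in> {1..K}"
    then show "c j \<in> A"
      using \<phi>[of j] i nth_mem[of i "\<phi> (w j)"] unfolding c_def by auto
  qed
  have out: "output_at K n m (blocks_encoder q \<phi>) w (i * N + s) k = Y c s k" if s: "s < t mod N" for s
  proof -
    have "i * N + t mod N = t"
      by (simp add: i_def)
    moreover have "s < N"
      using s N mod_less_divisor[of N t] by linarith
    ultimately have "i * N + s < t" "(i * N + s) div N = i" "(i * N + s) mod N = s"
      using s by simp_all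
    then have "input_at K n m (blocks_encoder q \<phi>) w (i * N + s) j = X c s j" if "j \<in> {1..K}" for j
      using less.IH[of "i * N + s" j] less.prems that by (simp add: c_def[abs_def])
    then show ?thesis
      using less.prems(1) next_user_in[OF less.prems(1)]
      by (simp add: output_at_def Y_def channel_output_def Let_def)
  qed
  have "drop (i * N) (received K n m (blocks_encoder q \<phi>) w t k) = map (\<lambda>s. Y c s k) [0..<t mod N]"
  proof (rule nth_equalityI)
    show "length (drop (i * N) (received K n m (blocks_encoder q \<phi>) w t k)) =
        length (map (\<lambda>s. Y c s k) [0..<t mod N])"
      by (simp add: received_eq_map i_def minus_div_mult_eq_mod)
    fix s assume "s < length (drop (i * N) (received K n m (blocks_encoder q \<phi>) w t k))"
    then have s: "s < t mod N"
      by (simp add: received_eq_map i_def minus_div_mult_eq_mod)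
    then have "i * N + s < t"
      using div_mult_mod_eq[of t N] unfolding i_def by linarith
    then show "drop (i * N) (received K n m (blocks_encoder q \<phi>) w t k) ! s =
        map (\<lambda>s. Y c s k) [0..<t mod N] ! s"
      using out[OF s] s by (simp add: received_eq_map)
  qed
  then show ?case
    using i block_encoder[OF c less.prems(1), of "t mod N"] N
    by (simp add: input_at_def blocks_encoder_Suc c_def[abs_def] i_def)
qed

lemma output_at_blocks_encoder:
  assumes \<phi>: "\<And>k. k \<in> {1..K} \<Longrightarrow> length (\<phi> (w k)) = q \<and> set (\<phi> (w k)) \<subseteq> A"
    and k: "k \<in> {1..K}" and t: "t < q * N"
  shows "output_at K n m (blocks_encoder q \<phi>) w t k = Y (\<lambda>j. \<phi> (w j) ! (t div N)) (t mod N) k"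
  using input_at_blocks_encoder[of \<phi> w q _ t, OF \<phi>] t k next_user_in[OF k]
  by (simp add: output_at_def Y_def channel_output_def Let_def)

lemma ex_zero_error_code:
  fixes T :: nat
  defines "M \<equiv> card A ^ (T div N)"
  shows "\<exists>f g. feedback_code K n m T (\<lambda>k. M) f g \<and>
    (\<forall>k\<in>{1..K}. error_prob K n m T (\<lambda>k. M) f g k = 0)"
proof -
  define q where "q = T div N"
  define W where "W = {xs. set xs \<subseteq> A \<and> length xs = q}"
  have "finite W" "card W = M"
    using A by (simp_all add: W_def M_def q_def finite_lists_length_eq card_lists_length_eq)
  \<comment> \<open>Messages number the words of \<open>q\<close> symbols, one symbol per block; any
    numbering serves.\<close>
  then obtain \<phi> where \<phi>: "bij_betw \<phi> {1..M} W"
    using finite_same_card_bij[of "{1..M}" W] by auto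
  have sep: "w k = w' k"
    if w: "w \<in> messages K (\<lambda>k. M)" "w' \<in> messages K (\<lambda>k. M)" and k: "k \<in> {1..K}"
      and eq: "received K n m (blocks_encoder q \<phi>) w T k = received K n m (blocks_encoder q \<phi>) w' T k"
    for w w' k
  proof -
    have msg: "v j \<in> {1..M}" if "v \<in> messages K (\<lambda>k. M)" "j \<in> {1..K}" for v j
      using that by (auto simp: messages_def PiE_dflt_def)
    have ok: "length (\<phi> (v j)) = q \<and> set (\<phi> (v j)) \<subseteq> A"
      if "v \<in> messages K (\<lambda>k. M)" "j \<in> {1..K}" for v j
      using bij_betwE[OF \<phi>] msg[OF that] by (auto simp: W_def)
    have nth_ok: "(\<lambda>j. \<phi> (v j) ! i) \<in> {1..K} \<rightarrow> A"
      if "v \<in> messages K (\<lambda>k. M)" "i < q" for v i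
    proof (rule Pi_I)
      fix j assume "j \<in> {1..K}"
      then show "\<phi> (v j) ! i \<in> A"
        using ok[OF that(1), of j] that(2) nth_mem[of i "\<phi> (v j)"] by auto
    qed
    have outs: "output_at K n m (blocks_encoder q \<phi>) w t k = output_at K n m (blocks_encoder q \<phi>) w' t k"
      if "t < T" for t
      using eq that by (simp add: received_eq_map)
    have qT: "q * N \<le> T"
      by (simp add: q_def)
    have "\<phi> (w k) ! i = \<phi> (w' k) ! i" if i: "i < q" for i
    proof (rule separating[of "\<lambda>j. \<phi> (w j) ! i" "\<lambda>j. \<phi> (w' j) ! i", OF _ _ k])
      show "(\<lambda>j. \<phi> (w j) ! i) \<in> {1..K} \<rightarrow> A" "(\<lambda>j. \<phi> (w' j) ! i) \<in> {1..K} \<rightarrow> A"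
        using nth_ok w i by blast+
      fix t p assume t: "t < N" and p: "p < max n m"
      have "i * N + t < Suc i * N"
        using t by simp
      also have "\<dots> \<le> q * N"
        using i by (intro mult_right_mono) auto
      finally have lt: "i * N + t < q * N" .
      have "output_at K n m (blocks_encoder q \<phi>) v (i * N + t) k = Y (\<lambda>j. \<phi> (v j) ! i) t k"
        if "v \<in> messages K (\<lambda>k. M)" for v
        using output_at_blocks_encoder[of \<phi> v q k "i * N + t"] ok[OF that] k lt t by simp
      then have "Y (\<lambda>j. \<phi> (w j) ! i) t k = Y (\<lambda>j. \<phi> (w' j) ! i) t k"
        using outs[OF order.strict_trans2[OF lt qT]] w by simp
      then show "channel_bit n m (x (\<lambda>j. \<phi> (w j) ! i) t k) (x (\<lambda>j. \<phi> (w j) ! i) t (next_user K k)) p =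
          channel_bit n m (x (\<lambda>j. \<phi> (w' j) ! i) t k) (x (\<lambda>j. \<phi> (w' j) ! i) t (next_user K k)) p"
        using output_bit_Y[OF p] by metis
    qed
    then have "\<phi> (w k) = \<phi> (w' k)"
      using ok[OF w(1) k] ok[OF w(2) k] by (intro nth_equalityI) auto
    then show ?thesis
      using bij_betw_imp_inj_on[OF \<phi>] msg[OF w(1) k] msg[OF w(2) k] by (auto dest: inj_onD)
  qed
  have len: "length (blocks_encoder q \<phi> k t w ys) = max n m" for k t w ys
    by (simp add: blocks_encoder_def Let_def length_block_encoder)
  have "M \<ge> 1"
    using A by (simp add: M_def Suc_le_eq card_gt_0_iff)
  then have "\<exists>g. feedback_code K n m T (\<lambda>k. M) (blocks_encoder q \<phi>) g \<and>
      (\<forall>k\<in>{1..K}. error_prob K n m T (\<lambda>k. M) (blocks_encoder q \<phi>) g k = 0)"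
    by (intro separating_encoder_gives_code len sep)
  then show ?thesis by blast
qed

lemma achievable: "achievable K n m (\<lambda>k. log 2 (card A) / N)"
  unfolding achievable_def
\<comment> \<open>Cutting \<open>T\<close> into full blocks wastes less than one block, and
  \<open>T \<le> (T div N + 1) * N\<close> bounds the rate loss by this value.\<close>
proof (rule exI[of _ "\<lambda>k (T::nat). log 2 (card A) / T"], intro conjI ballI allI impI)
  show "(\<lambda>T. log 2 (card A) / real T) \<longlonglongrightarrow> 0"
    by (rule lim_const_over_n)
  fix T :: nat assume T: "T \<ge> 1"
  obtain f g where code: "feedback_code K n m T (\<lambda>k. card A ^ (T div N)) f g"
    "\<forall>k\<in>{1..K}. error_prob K n m T (\<lambda>k. card A ^ (T div N)) f g k = 0"
    using ex_zero_error_code[of T] by blast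
  have cA: "card A \<ge> 1"
    using A by (simp add: Suc_le_eq card_gt_0_iff)
  then have log: "log 2 (card A) \<ge> 0"
    by simp
  have "T = T div N * N + T mod N"
    by simp
  also have "\<dots> \<le> T div N * N + N"
    using N by (intro add_left_mono less_imp_le mod_less_divisor) simp
  finally have "T \<le> (T div N + 1) * N" by simp
  then have "real T \<le> (real (T div N) + 1) * real N"
    by (metis of_nat_1 of_nat_add of_nat_le_iff of_nat_mult)
  then have "1 / real N \<le> (real (T div N) + 1) / real T"
    using N T by (simp add: field_simps)
  then have "log 2 (card A) * (1 / real N) \<le> log 2 (card A) * ((real (T div N) + 1) / real T)"
    using log by (rule mult_left_mono)
  then have "log 2 (card A) / N - log 2 (card A) / T \<le> real (T div N) * log 2 (card A) / T"
    by (simp add: algebra_simps add_divide_distrib)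
  also have "real (T div N) * log 2 (card A) = log 2 (real (card A ^ (T div N)))"
    using cA by (simp add: log_nat_power)
  finally show "\<exists>M f g. feedback_code K n m T M f g \<and>
      (\<forall>k\<in>{1..K}. log 2 (card A) / N - log 2 (card A) / T \<le> log 2 (real (M k)) / real T \<and>
        error_prob K n m T M f g k \<le> log 2 (card A) / T)"
    using code log by (intro exI[of _ "\<lambda>k. card A ^ (T div N)"] exI[of _ f] exI[of _ g]) simp
qed

end

section \<open>Block schemes\<close>

lemma slot_scheme_achievable:
  assumes "finite D" and "block_scheme K n m N (D \<rightarrow>\<^sub>E (UNIV :: bit set)) x"
  shows "achievable K n m (\<lambda>k. card D / N)"
  using block_scheme.achievable[OF assms(2)] card_bit_functions[OF assms(1)]
  by (simp add: log_nat_power)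

lemma bit_functions_nonempty: "(D \<rightarrow>\<^sub>E (UNIV :: bit set)) \<noteq> {}"
  by (simp add: PiE_eq_empty_iff)

lemma bit_functions_eqI:
  assumes "c \<in> I \<rightarrow> (D \<rightarrow>\<^sub>E (UNIV :: bit set))" "c' \<in> I \<rightarrow> (D \<rightarrow>\<^sub>E UNIV)" "k \<in> I"
    and "\<And>t p. (t, p) \<in> D \<Longrightarrow> c k (t, p) = c' k (t, p)"
  shows "c k = c' k"
proof -
  have "c k \<in> D \<rightarrow>\<^sub>E UNIV" "c' k \<in> D \<rightarrow>\<^sub>E UNIV"
    using assms by auto
  then show ?thesis
    using assms(4) by (intro PiE_ext[of "c k" D "\<lambda>_. UNIV" "c' k"]) auto
qed

text \<open>This is what feedback teaches: with its own input known, a transmitter learns the top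
  \<open>m\<close> bits of its successor.\<close>

lemma channel_bit_hear:
  assumes "p < m" and out: "\<And>q. q < max n m \<Longrightarrow> channel_bit n m a b q = channel_bit n m a' b' q"
    and own: "\<And>q. q < max n m \<Longrightarrow> a q = a' q"
  shows "b p = b' p"
proof (cases "m \<le> n")
  case True
  have "channel_bit n m a b (p + (n - m)) = a (p + (n - m)) + b p" for a b
    unfolding channel_bit_def by (simp only: True if_True le_add2 add_diff_cancel_right')
  moreover have "p + (n - m) < max n m"
    using assms(1) True by linarith
  ultimately show ?thesis
    using out[of "p + (n - m)"] own[of "p + (n - m)"] by simp
next
  case False
  then have "p < max n m" "p - (m - n) < max n m"
    using assms(1) by auto
  then show ?thesis
    using out[of p] own[of "p - (m - n)"] False by (simp add: channel_bit_def split: if_splits)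
qed

section \<open>Relay schemes around the ring\<close>

lemma next_user_funpow:
  assumes "k \<in> {1..K}" "t \<le> K"
  shows "(next_user K ^^ t) k = (if k + t \<le> K then k + t else k + t - K)"
  using assms(2)
proof (induction t)
  case (Suc t)
  then show ?case
    using assms(1) by (auto simp: next_user_def)
qed (use assms in auto)

lemma next_user_cycle: "k \<in> {1..K} \<Longrightarrow> (next_user K ^^ K) k = k"
  by (simp add: next_user_funpow)

text \<open>
  A message is a function on slots \<open>(t, p)\<close>.  The relay positions \<open>R\<close> hold fresh bits only at time 0;
  at time \<open>t\<close> they hold those of the \<open>t\<close>-th successor of \<open>k\<close>.
\<close>

definition relay_input ::
    "nat \<Rightarrow> nat set \<Rightarrow> nat set \<Rightarrow> (nat \<Rightarrow> nat \<times> nat \<Rightarrow> bit) \<Rightarrow> nat \<Rightarrow> nat \<Rightarrow> nat \<Rightarrow> bit" where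
  "relay_input K R F c t k p =
     (if p \<in> R then c ((next_user K ^^ t) k) (0, p) else if p \<in> F then c k (t, p) else 0)"

text \<open>The relay bits due at time \<open>Suc s\<close> are those that the successor sends at
  time \<open>s\<close>; they are heard because \<open>R\<close> lies in the top \<open>m\<close>
  positions.\<close>

lemma relay_input_causal:
  assumes R: "R \<subseteq> {..<m}" and ck: "c k = c' k"
    and out: "\<And>s q. s < t \<Longrightarrow> q < max n m \<Longrightarrow>
      channel_bit n m (relay_input K R F c s k) (relay_input K R F c s (next_user K k)) q =
      channel_bit n m (relay_input K R F c' s k) (relay_input K R F c' s (next_user K k)) q"
  shows "relay_input K R F c t k p = relay_input K R F c' t k p"
proof -
  have "\<forall>p\<in>R. c ((next_user K ^^ s) k) (0, p) = c' ((next_user K ^^ s) k) (0, p)" if "s \<le> t" for s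
    using that
  proof (induction s)
    case 0
    then show ?case using ck by simp
  next
    case (Suc s)
    then have own: "relay_input K R F c s k q = relay_input K R F c' s k q" for q
      using ck by (simp add: relay_input_def)
    have "relay_input K R F c s (next_user K k) p = relay_input K R F c' s (next_user K k) p"
      if "p \<in> R" for p
      using channel_bit_hear[OF _ out[of s] own] that R Suc.prems by auto
    then show ?case
      by (simp add: relay_input_def funpow_swap1)
  qed
  then show ?thesis
    using ck by (simp add: relay_input_def)
qed

definition relay_slots :: "nat \<Rightarrow> nat set \<Rightarrow> nat set \<Rightarrow> (nat \<times> nat) set" where
  "relay_slots K R F = {0} \<times> R \<union> {..<K} \<times> F"

text \<open>With \<open>R\<close> in the top \<open>m\<close> positions causality is automatic and
  only decodability is left. Per block a relay position carries one bit, a fresh position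
  \<open>K\<close> bits.\<close>

lemma relay_achievable:
  assumes K: "K \<ge> 1" and R: "R \<subseteq> {..<m}" and F: "finite F" and disj: "R \<inter> F = {}"
    and sep: "\<And>c c' k t p. k \<in> {1..K} \<Longrightarrow>
      (\<And>t p. t < K \<Longrightarrow> p < max n m \<Longrightarrow>
        channel_bit n m (relay_input K R F c t k) (relay_input K R F c t (next_user K k)) p =
        channel_bit n m (relay_input K R F c' t k) (relay_input K R F c' t (next_user K k)) p) \<Longrightarrow>
      (t, p) \<in> relay_slots K R F \<Longrightarrow> c k (t, p) = c' k (t, p)"
  shows "achievable K n m (\<lambda>k. (card R + K * card F) / K)"
proof -
  have finR: "finite R"
    using R finite_subset by blast
  have fin: "finite (relay_slots K R F)"
    using finR F by (simp add: relay_slots_def)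
  have "card (relay_slots K R F) = card ({0::nat} \<times> R) + card ({..<K} \<times> F)"
    unfolding relay_slots_def by (rule card_Un_disjoint) (use finR F disj in auto)
  then have "card (relay_slots K R F) = card R + K * card F"
    by (simp add: card_cartesian_product)
  moreover have "block_scheme K n m K (relay_slots K R F \<rightarrow>\<^sub>E UNIV) (relay_input K R F)"
  proof
    show "K \<ge> 1" by (rule K)
    show "finite (relay_slots K R F \<rightarrow>\<^sub>E (UNIV :: bit set))"
      by (rule finite_bit_functions[OF fin])
    show "(relay_slots K R F \<rightarrow>\<^sub>E (UNIV :: bit set)) \<noteq> {}"
      by (rule bit_functions_nonempty)
  next
    fix c c' k t p
    assume "c k = c' k" and
      "\<And>s q. s < t \<Longrightarrow> q < max n m \<Longrightarrow>
        channel_bit n m (relay_input K R F c s k) (relay_input K R F c s (next_user K k)) q =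
        channel_bit n m (relay_input K R F c' s k) (relay_input K R F c' s (next_user K k)) q"
    then show "relay_input K R F c t k p = relay_input K R F c' t k p"
      by (rule relay_input_causal[OF R])
  next
    fix c c' k
    assume c: "c \<in> {1..K} \<rightarrow> (relay_slots K R F \<rightarrow>\<^sub>E (UNIV :: bit set))"
      "c' \<in> {1..K} \<rightarrow> (relay_slots K R F \<rightarrow>\<^sub>E (UNIV :: bit set))" and k: "k \<in> {1..K}"
      and out: "\<And>t p. t < K \<Longrightarrow> p < max n m \<Longrightarrow>
        channel_bit n m (relay_input K R F c t k) (relay_input K R F c t (next_user K k)) p =
        channel_bit n m (relay_input K R F c' t k) (relay_input K R F c' t (next_user K k)) p"
    show "c k = c' k"
      by (rule bit_functions_eqI[OF c k sep[OF k out]])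
  qed
  ultimately show ?thesis
    using slot_scheme_achievable[OF fin] by metis
qed

text \<open>Relay positions are received undisturbed. By \<open>shift\<close>, a fresh position is
  disturbed at most by a relay bit, which the own transmitter repeats one use later, so its receiver
  can subtract it.\<close>

lemma relay_achievable_le:
  assumes K: "K \<ge> 1" and mn: "m \<le> n" and R: "R \<subseteq> {..<min m (n - m)}" and F: "F \<subseteq> {..<n}"
    and disj: "R \<inter> F = {}" and shift: "\<And>p. p \<in> F \<Longrightarrow> n - m \<le> p \<Longrightarrow> p - (n - m) \<notin> F"
  shows "achievable K n m (\<lambda>k. (card R + K * card F) / K)"
proof (rule relay_achievable[OF K _ _ disj])
  show "R \<subseteq> {..<m}" "finite F"
    using R F finite_subset by auto
  fix c c' :: "nat \<Rightarrow> nat \<times> nat \<Rightarrow> bit" and k t p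
  assume k: "k \<in> {1..K}" and slot: "(t, p) \<in> relay_slots K R F"
    and out: "\<And>t p. t < K \<Longrightarrow> p < max n m \<Longrightarrow>
        channel_bit n m (relay_input K R F c t k) (relay_input K R F c t (next_user K k)) p =
        channel_bit n m (relay_input K R F c' t k) (relay_input K R F c' t (next_user K k)) p"
  have clean: "relay_input K R F c t k p = relay_input K R F c' t k p" if "t < K" "p < n - m" for t p
    using out[of t p] that mn by (simp add: channel_bit_def)
  \<comment> \<open>At \<open>t = K\<close> the ring closes: the bits are those of \<open>k\<close>,
    read at time 0. This settles the interference of the last use.\<close>
  have relay: "c ((next_user K ^^ t) k) (0, p) = c' ((next_user K ^^ t) k) (0, p)"
    if "t \<le> K" "p \<in> R" for t p
  proof -
    have "c ((next_user K ^^ t) k) (0, p) = c' ((next_user K ^^ t) k) (0, p)" if "t < K" for t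
      using clean[OF that, of p] \<open>p \<in> R\<close> R by (auto simp: relay_input_def)
    from this[of t] this[of 0] show ?thesis
      using that(1) K k next_user_cycle[OF k] by (cases "t = K") auto
  qed
  have interference: "relay_input K R F c t (next_user K k) (p - (n - m)) =
      relay_input K R F c' t (next_user K k) (p - (n - m))" if "t < K" "p \<in> F" "n - m \<le> p" for t p
  proof -
    have "c ((next_user K ^^ t) (next_user K k)) (0, q) = c' ((next_user K ^^ t) (next_user K k)) (0, q)"
      if "q \<in> R" for q
      using relay[of "Suc t" q] that \<open>t < K\<close> by (simp add: funpow_swap1)
    then show ?thesis
      using shift[OF that(2,3)] by (simp add: relay_input_def)
  qed
  show "c k (t, p) = c' k (t, p)"
  proof (cases "p \<in> R")
    case True
    then show ?thesis
      using relay[of 0 p] slot disj K by (auto simp: relay_slots_def)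
  next
    case False
    then have tp: "t < K" "p \<in> F" "p < n"
      using slot F by (auto simp: relay_slots_def)
    have "relay_input K R F c t k p = relay_input K R F c' t k p"
      using out[OF tp(1), of p] interference[OF tp(1,2)] tp(3) mn
      by (cases "n - m \<le> p") (simp_all add: channel_bit_def)
    then show ?thesis
      using False tp by (simp add: relay_input_def)
  qed
qed

text \<open>The successor's relay positions arrive free of the own signal, and the own fresh bits
  land in the lowest \<open>n\<close> positions, which the successor leaves empty.\<close>

lemma relay_achievable_ge:
  assumes K: "K \<ge> 1" and mn: "2 * n \<le> m" "n \<ge> 1"
  shows "achievable K n m (\<lambda>k. (card {n..<m - n} + K * card {..<n}) / K)"
proof (rule relay_achievable[OF K])
  let ?R = "{n..<m - n}" and ?F = "{..<n}"
  show "?R \<subseteq> {..<m}" "finite ?F" "?R \<inter> ?F = {}"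
    by auto
  fix c c' :: "nat \<Rightarrow> nat \<times> nat \<Rightarrow> bit" and k t p
  assume k: "k \<in> {1..K}" and slot: "(t, p) \<in> relay_slots K ?R ?F"
    and out: "\<And>t p. t < K \<Longrightarrow> p < max n m \<Longrightarrow>
        channel_bit n m (relay_input K ?R ?F c t k) (relay_input K ?R ?F c t (next_user K k)) p =
        channel_bit n m (relay_input K ?R ?F c' t k) (relay_input K ?R ?F c' t (next_user K k)) p"
  show "c k (t, p) = c' k (t, p)"
  proof (cases "p \<in> ?R")
    case True
    \<comment> \<open>In the last use the successor relays the bits of \<open>k\<close>
      itself.\<close>
    have "(next_user K ^^ (K - 1)) (next_user K k) = k"
      using next_user_cycle[OF k] K funpow_Suc_right[of "K - 1" "next_user K"] by simp
    then show ?thesis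
      using out[of "K - 1" p] True slot K mn
      by (auto simp: channel_bit_def relay_input_def relay_slots_def)
  next
    case False
    then have tp: "t < K" "p < n"
      using slot by (auto simp: relay_slots_def)
    have "channel_bit n m (relay_input K ?R ?F c t k) (relay_input K ?R ?F c t (next_user K k)) (p + (m - n))
        = c k (t, p)" for c
    proof -
      have "p + (m - n) \<notin> ?R" "p + (m - n) \<notin> ?F"
        using tp mn by auto
      then have "relay_input K ?R ?F c t (next_user K k) (p + (m - n)) = 0"
        by (simp only: relay_input_def if_False)
      moreover have "relay_input K ?R ?F c t k p = c k (t, p)"
        using tp mn by (simp add: relay_input_def)
      moreover have "\<not> m \<le> n"
        using mn by linarith
      ultimately show ?thesis
        unfolding channel_bit_def by (simp only: if_False le_add2 if_True add_diff_cancel_right' add_0_left)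
    qed
    moreover have "p + (m - n) < max n m"
      using tp mn by linarith
    ultimately show ?thesis
      using out[OF tp(1)] by metis
  qed
qed

section \<open>Two-use schemes without feedback\<close>

definition even_layer :: "nat \<Rightarrow> nat \<Rightarrow> bool" where
  "even_layer d p \<longleftrightarrow> even (p div d)"

lemma even_layer_add [simp]: "d > 0 \<Longrightarrow> even_layer d (p + d) \<longleftrightarrow> \<not> even_layer d p"
  by (simp add: even_layer_def)

lemma even_layer_diff: "d > 0 \<Longrightarrow> d \<le> p \<Longrightarrow> even_layer d (p - d) \<longleftrightarrow> \<not> even_layer d p"
  using even_layer_add[of d "p - d"] by simp

lemma even_layer_less: "p < d \<Longrightarrow> even_layer d p"
  by (simp add: even_layer_def)

text \<open>
  Below \<open>m\<close> only even layers carry fresh bits.  A position \<open>p\<close> in an even layer with \<open>m \<le> p + d\<close>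
  has no empty partner \<open>p + d\<close>; it is used at time 0 only, and its bit is repeated at time 1 in the
  empty position \<open>p - d\<close>.
\<close>

definition layered_input ::
    "nat \<Rightarrow> nat \<Rightarrow> (nat \<Rightarrow> nat \<times> nat \<Rightarrow> bit) \<Rightarrow> nat \<Rightarrow> nat \<Rightarrow> nat \<Rightarrow> bit" where
  "layered_input d m c t k p =
     (if p \<ge> m then c k (t, p)
      else if even_layer d p then (if t = 0 \<or> p + d < m then c k (t, p) else 0)
      else if t = 1 \<and> p + d < m \<and> m \<le> p + 2 * d then c k (0, p + d) else 0)"

text \<open>With \<open>l = max n m\<close>, positions from \<open>m\<close> on exist only for
  \<open>m < n\<close>. They disturb nobody and carry fresh bits in both uses.\<close>

definition layered_slots :: "nat \<Rightarrow> nat \<Rightarrow> nat \<Rightarrow> (nat \<times> nat) set" where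
  "layered_slots d m l =
     {0} \<times> {p. p < m \<and> even_layer d p} \<union> {1} \<times> {p. p + d < m \<and> even_layer d p} \<union> {0, 1} \<times> {m..<l}"

lemma finite_layered_slots: "finite (layered_slots d m l)"
proof -
  have "layered_slots d m l \<subseteq> {0, 1} \<times> {..<m + l}"
    by (auto simp: layered_slots_def)
  then show ?thesis
    by (rule finite_subset) simp
qed

text \<open>The shift by \<open>d\<close> matches the even positions that have a partner with the
  odd ones, so below \<open>m\<close> the two uses together hold exactly \<open>m\<close> fresh
  bits.\<close>

lemma card_layered_slots:
  assumes "d > 0"
  shows "card (layered_slots d m l) = m + 2 * (l - m)"
proof -
  let ?E = "{p. p < m \<and> even_layer d p}" and ?E' = "{p. p + d < m \<and> even_layer d p}"
    and ?O = "{p. p < m \<and> \<not> even_layer d p}"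
  have fin: "finite ?E" "finite ?E'" "finite ?O"
    by (auto intro: finite_subset[of _ "{..<m}"])
  have "bij_betw (\<lambda>p. p + d) ?E' ?O"
  proof (rule bij_betwI')
    fix q assume q: "q \<in> ?O"
    then have "d \<le> q"
      using even_layer_less[of q d] by (cases "d \<le> q") auto
    then show "\<exists>p\<in>?E'. q = p + d"
      using q even_layer_diff[OF assms, of q] by (intro bexI[of _ "q - d"]) auto
  qed (use assms in auto)
  then have "card ?E' = card ?O"
    by (rule bij_betw_same_card)
  moreover have "card ?E + card ?O = m"
  proof -
    have "?E \<union> ?O = {..<m}" "?E \<inter> ?O = {}"
      by auto
    then show ?thesis
      using card_Un_disjoint[OF fin(1,3)] by simp
  qed
  moreover have "card (layered_slots d m l) = card ({0::nat} \<times> ?E \<union> {1} \<times> ?E') + card ({0::nat, 1} \<times> {m..<l})"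
    unfolding layered_slots_def by (rule card_Un_disjoint) (use fin in auto)
  moreover have "card ({0::nat} \<times> ?E \<union> {1} \<times> ?E') = card ({0::nat} \<times> ?E) + card ({1::nat} \<times> ?E')"
    by (rule card_Un_disjoint) (use fin in auto)
  ultimately show ?thesis
    by (simp add: card_cartesian_product)
qed

text \<open>\<open>2 * d \<le> m\<close> means \<open>2 * n \<le> 3 * m\<close> for
  \<open>m < n\<close> and \<open>m \<le> 2 * n\<close> for \<open>n < m\<close>. Below
  \<open>m\<close> an even layer meets an odd layer of the other signal, which is empty except for
  repetitions at time 1.\<close>

lemma layered_achievable:
  assumes mn: "m \<noteq> n" and d: "d = (if m < n then n - m else m - n)" and dm: "2 * d \<le> m"
  shows "achievable K n m (\<lambda>k. real (m + 2 * (max n m - m)) / 2)"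
proof -
  let ?x = "layered_input d m" and ?D = "layered_slots d m (max n m)"
  have d0: "d > 0"
    using mn d by auto
  have "block_scheme K n m 2 (?D \<rightarrow>\<^sub>E UNIV) ?x"
  proof
    show "(2::nat) \<ge> 1" by simp
    show "finite (?D \<rightarrow>\<^sub>E (UNIV :: bit set))"
      by (rule finite_bit_functions[OF finite_layered_slots])
    show "(?D \<rightarrow>\<^sub>E (UNIV :: bit set)) \<noteq> {}"
      by (rule bit_functions_nonempty)
    show "?x c t k p = ?x c' t k p" if "c k = c' k" for c c' t k p
      using that by (simp add: layered_input_def)
  next
    fix c c' k
    assume c: "c \<in> {1..K} \<rightarrow> (?D \<rightarrow>\<^sub>E (UNIV :: bit set))"
      "c' \<in> {1..K} \<rightarrow> (?D \<rightarrow>\<^sub>E (UNIV :: bit set))" and k: "k \<in> {1..K}"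
      and out: "\<And>t p. t < 2 \<Longrightarrow> p < max n m \<Longrightarrow>
        channel_bit n m (?x c t k) (?x c t (next_user K k)) p =
        channel_bit n m (?x c' t k) (?x c' t (next_user K k)) p"
    let ?j = "next_user K k"
    have "c k (t, p) = c' k (t, p)" if slot: "(t, p) \<in> ?D" for t p
    proof (cases "m < n")
      case True
      have bit: "channel_bit n m a b p = a p + (if d \<le> p then b (p - d) else 0)" for a b p
        using True by (simp only: channel_bit_def d less_imp_le if_True)
      have out: "?x c t k p + (if d \<le> p then ?x c t ?j (p - d) else 0) =
          ?x c' t k p + (if d \<le> p then ?x c' t ?j (p - d) else 0)" if "t < 2" "p < n" for t p
        using out[OF that(1), of p] that(2) by (simp add: bit)
      have layer_zero: "?x c t i (p - d) = 0"
        if "d \<le> p" "even_layer d p" "p < m" "t = 1 \<longrightarrow> p + d < m" for c t i p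
        using that even_layer_diff[OF d0 that(1)] by (auto simp: layered_input_def)
      consider "p < m" "even_layer d p" "t = 0" | "p < m" "even_layer d p" "t = 1" "p + d < m"
        | "p \<ge> m" "p < n" "t = 0" | "p \<ge> m" "p < n" "t = 1"
        using slot True by (auto simp: layered_slots_def)
      then show ?thesis
      proof cases
        case 1
        then show ?thesis
          using out[of 0 p] True layer_zero[of p 0 c] layer_zero[of p 0 c']
          by (cases "d \<le> p") (simp_all add: layered_input_def)
      next
        case 2
        then show ?thesis
          using out[of 1 p] True layer_zero[of p 1 c] layer_zero[of p 1 c']
          by (cases "d \<le> p") (simp_all add: layered_input_def)
      next
        case 3
        have p: "d \<le> p" "d \<le> p - d" "p - d < m" "p - d + d = p"
          using 3 dm d True by auto
        \<comment> \<open>If position \<open>p - d\<close> of the successor is occupied, its bit is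
          repeated at time 1 in \<open>p - 2 * d\<close> and arrives at \<open>p - d\<close>, where
          the own input is then zero.\<close>
        have "?x c 0 ?j (p - d) = ?x c' 0 ?j (p - d)"
        proof (cases "even_layer d (p - d)")
          case True
          have "?x c 1 k (p - d) = 0" "?x c 1 ?j (p - d - d) = c ?j (0, p - d)" for c
            using True p 3 even_layer_diff[OF d0 p(2)] by (auto simp: layered_input_def)
          then show ?thesis
            using out[of 1 "p - d"] p 3 True by (simp add: layered_input_def)
        next
          case False
          then show ?thesis
            using p by (simp add: layered_input_def)
        qed
        then show ?thesis
          using out[of 0 p] 3 p by (simp add: layered_input_def)
      next
        case 4
        have p: "d \<le> p" "p - d < m" "p - d + d = p"
          using 4 dm d True by auto
        \<comment> \<open>Position \<open>p - d\<close> has no partner below \<open>m\<close>, so at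
          time 1 it is empty in either kind of layer.\<close>
        have "?x c 1 ?j (p - d) = 0" for c
          using p 4 by (simp add: layered_input_def)
        then show ?thesis
          using out[of 1 p] 4 p by (simp add: layered_input_def)
      qed
    next
      case False
      then have nm: "n < m"
        using mn by simp
      have bit: "channel_bit n m a b p = b p + (if d \<le> p then a (p - d) else 0)" for a b p
      proof -
        have "\<not> m \<le> n"
          using nm by simp
        then show ?thesis
          using False by (simp only: channel_bit_def d if_False)
      qed
      have out: "?x c t ?j p + (if d \<le> p then ?x c t k (p - d) else 0) =
          ?x c' t ?j p + (if d \<le> p then ?x c' t k (p - d) else 0)" if "t < 2" "p < m" for t p
        using out[OF that(1), of p] that(2) by (simp add: bit)
      have out_add: "?x c t ?j (p + d) + ?x c t k p = ?x c' t ?j (p + d) + ?x c' t k p"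
        if "t < 2" "p + d < m" for t p
        using out[OF that] by simp
      consider "p + d < m" "even_layer d p" "t = 0" | "p < m" "m \<le> p + d" "even_layer d p" "t = 0"
        | "p + d < m" "even_layer d p" "t = 1"
        using slot nm by (cases "p + d < m") (auto simp: layered_slots_def not_less)
      then show ?thesis
      proof cases
        case 1
        then show ?thesis
          using out_add[of 0 p] d0 by (simp add: layered_input_def)
      next
        case 2
        \<comment> \<open>At time 0 this bit is shifted off the output; it is read from its
          repetition in \<open>p - d\<close> at time 1.\<close>
        have p: "d \<le> p"
          using 2 dm by linarith
        then have "d \<le> p - d"
          using even_layer_diff[OF d0 p] even_layer_less[of "p - d" d] 2 by (meson not_le)
        then have "?x c 1 ?j p = 0" "?x c 1 k (p - d) = c k (0, p)" for c
          using 2 p even_layer_diff[OF d0 p] by (auto simp: layered_input_def)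
        then show ?thesis
          using out[of 1 p] p 2 by simp
      next
        case 3
        \<comment> \<open>The interference may repeat the successor's bit of position
          \<open>p + 2 * d\<close>, which was heard at time 0 against the own empty odd
          layer.\<close>
        have "?x c 1 ?j (p + d) = ?x c' 1 ?j (p + d)"
        proof (cases "p + d + d < m")
          case True
          have "?x c 0 k (p + d) = 0" "?x c 0 ?j (p + d + d) = c ?j (0, p + d + d)" for c
            using True 3 d0 by (simp_all add: layered_input_def)
          then have "c ?j (0, p + d + d) = c' ?j (0, p + d + d)"
            using out_add[of 0 "p + d"] True by simp
          then show ?thesis
            using 3 d0 by (simp add: layered_input_def)
        next
          case False
          then show ?thesis
            using 3 d0 by (simp add: layered_input_def)
        qed
        then show ?thesis
          using out_add[of 1 p] 3 by (simp add: layered_input_def)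
      qed
    qed
    then show "c k = c' k"
      by (rule bit_functions_eqI[OF c k])
  qed
  from slot_scheme_achievable[OF finite_layered_slots this] show ?thesis
    by (simp only: card_layered_slots[OF d0] of_nat_numeral)
qed

text \<open>
  For \<open>n = m\<close> there are no layers.  Odd and even users take turns; if \<open>K\<close> is odd, then user \<open>K\<close>,
  whose successor 1 is odd as well, sends its bits in both uses.
\<close>

definition alternating_input ::
    "nat \<Rightarrow> (nat \<Rightarrow> nat \<times> nat \<Rightarrow> bit) \<Rightarrow> nat \<Rightarrow> nat \<Rightarrow> nat \<Rightarrow> bit" where
  "alternating_input K c t k p =
     (if odd k \<and> k = K \<or> (t = 0 \<longleftrightarrow> odd k) then c k (0, p) else 0)"

text \<open>An odd user below \<open>K\<close> sends at time 0 against a silent successor; an odd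
  \<open>K\<close> is decoded at time 1, when user 1 is silent.\<close>

lemma alternating_achievable:
  assumes K: "K \<ge> 2"
  shows "achievable K n n (\<lambda>k. n / 2)"
proof -
  let ?x = "alternating_input K" and ?D = "{0::nat} \<times> {..<n}"
  have "block_scheme K n n 2 (?D \<rightarrow>\<^sub>E UNIV) ?x"
  proof
    show "(2::nat) \<ge> 1" by simp
    show "finite (?D \<rightarrow>\<^sub>E (UNIV :: bit set))"
      by (rule finite_bit_functions) simp
    show "(?D \<rightarrow>\<^sub>E (UNIV :: bit set)) \<noteq> {}"
      by (rule bit_functions_nonempty)
    show "?x c t k p = ?x c' t k p" if "c k = c' k" for c c' t k p
      by (simp only: alternating_input_def that)
  next
    fix c c' k
    assume c: "c \<in> {1..K} \<rightarrow> (?D \<rightarrow>\<^sub>E (UNIV :: bit set))"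
      "c' \<in> {1..K} \<rightarrow> (?D \<rightarrow>\<^sub>E (UNIV :: bit set))" and k: "k \<in> {1..K}"
      and out: "\<And>t p. t < 2 \<Longrightarrow> p < max n n \<Longrightarrow>
        channel_bit n n (?x c t k) (?x c t (next_user K k)) p =
        channel_bit n n (?x c' t k) (?x c' t (next_user K k)) p"
    let ?j = "next_user K k"
    have "c k (t, p) = c' k (t, p)" if slot: "(t, p) \<in> ?D" for t p
    proof -
      have tp: "t = 0" "p < n"
        using slot by auto
      have out: "?x c s k p + ?x c s ?j p = ?x c' s k p + ?x c' s ?j p" if "s < 2" for s
        using out[OF that, of p] tp by (simp add: channel_bit_def)
      consider "odd k" "k = K" | "odd k" "k < K" | "even k"
        using k by fastforce
      then show ?thesis
      proof cases
        case 1
        then have "?x c 1 ?j p = 0" "?x c 1 k p = c k (0, p)" for c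
          using K by (auto simp: alternating_input_def next_user_def)
        then show ?thesis
          using out[of 1] tp by simp
      next
        case 2
        then have "?x c 0 ?j p = 0" "?x c 0 k p = c k (0, p)" for c
          by (auto simp: alternating_input_def next_user_def)
        then show ?thesis
          using out[of 0] tp by simp
      next
        case 3
        then have "odd ?j"
          by (simp add: next_user_def)
        then have "?x c 0 k p = 0" "?x c 0 ?j p = c ?j (0, p)" "?x c 1 k p = c k (0, p)" for c
          using 3 by (auto simp: alternating_input_def)
        \<comment> \<open>The successor may be an odd \<open>K\<close> that sends again at time 1;
          its bits were heard at time 0, when \<open>k\<close> was silent.\<close>
        then have "c ?j (0, p) = c' ?j (0, p)"
          using out[of 0] by simp
        then have "?x c 1 ?j p = ?x c' 1 ?j p"
          by (simp add: alternating_input_def)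
        then show ?thesis
          using out[of 1] tp \<open>\<And>c. ?x c 1 k p = c k (0, p)\<close> by simp
      qed
    qed
    then show "c k = c' k"
      by (rule bit_functions_eqI[OF c k])
  qed
  from slot_scheme_achievable[OF _ this] show ?thesis by simp
qed

section \<open>The symmetric capacity\<close>

text \<open>One symmetric tuple that meets a sum-rate bound makes the bound a greatest
  element.\<close>

lemma fb_sym_capacity_eqI:
  assumes K: "K \<ge> 2" and r: "r \<ge> 0" and ach: "achievable K n m (\<lambda>k. r)"
    and bound: "\<And>R. achievable K n m R \<Longrightarrow> (\<Sum>k\<in>{1..K}. R k) \<le> real K * r"
  shows "fb_sym_capacity K n m = r / real n"
proof -
  \<comment> \<open>Tuples of the region are undefined outside the users, hence the
    restriction.\<close>
  have "achievable K n m (restrict (\<lambda>k. r) {1..K})"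
    using ach by (simp add: achievable_def)
  then have "restrict (\<lambda>k. r) {1..K} \<in> fb_capacity_region K n m"
    using r by (simp add: fb_capacity_region_def)
  moreover have "(\<Sum>k=1..K. restrict (\<lambda>k. r) {1..K} k) = real K * r"
    by simp
  ultimately have "\<exists>R\<in>fb_capacity_region K n m. real K * r = (\<Sum>k=1..K. R k)"
    by metis
  then have "fb_sum_capacity K n m = real K * r"
    unfolding fb_sum_capacity_def
    by (rule Greatest_equality) (use bound in \<open>auto simp: fb_capacity_region_def\<close>)
  then show ?thesis
    using K by (simp add: fb_sym_capacity_def)
qed

lemma fb_sym_capacity_le_half:
  assumes K: "K \<ge> 2" and mn: "2 * m \<le> n"
  shows "fb_sym_capacity K n m = real (m + K * (n - m)) / real K / real n"
proof (rule fb_sym_capacity_eqI[OF K])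
  \<comment> \<open>All top \<open>m\<close> positions relay, so only relay bits interfere.\<close>
  have "achievable K n m (\<lambda>k. real (card {..<m} + K * card {m..<n}) / real K)"
    by (rule relay_achievable_le) (use K mn in auto)
  then show "achievable K n m (\<lambda>k. real (m + K * (n - m)) / real K)"
    by (simp only: card_lessThan card_atLeastLessThan)
  obtain i where i: "K = i + 2"
    using K by (metis add.commute le_Suc_ex)
  obtain j where j: "n = 2 * m + j"
    using mn le_Suc_ex by blast
  have "n + (K - 2) * max (n - m) m + (n - m) = m + K * (n - m)"
    by (simp add: i j algebra_simps)
  then show "(\<Sum>k\<in>{1..K}. R k) \<le> real K * (real (m + K * (n - m)) / real K)"
    if "achievable K n m R" for R
    using sum_rate_bound_le[OF that K] K mn by simp
qed simp

lemma fb_sym_capacity_half_to_two_thirds: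
  assumes K: "K \<ge> 2" and mn: "n \<le> 2 * m" "3 * m \<le> 2 * n"
  shows "fb_sym_capacity K n m = real (2 * n - 3 * m + K * m) / real K / real n"
proof (rule fb_sym_capacity_eqI[OF K])
  \<comment> \<open>Positions from \<open>n - m\<close> to \<open>m\<close> stay empty: there the
    fresh bits of \<open>{..<2 * m - n}\<close> interfere. Positions from \<open>m\<close> on meet
    only relay and empty positions.\<close>
  have "achievable K n m (\<lambda>k. real (card {2 * m - n..<n - m} +
      K * card ({..<2 * m - n} \<union> {m..<n})) / real K)"
    by (rule relay_achievable_le) (use K mn in auto)
  moreover have "card ({..<2 * m - n} \<union> {m..<n}) = m"
    by (subst card_Un_disjoint) (use mn in auto)
  moreover have "card {2 * m - n..<n - m} = 2 * n - 3 * m"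
    using mn by simp
  ultimately show "achievable K n m (\<lambda>k. real (2 * n - 3 * m + K * m) / real K)"
    by (simp only:)
  obtain i where i: "K = i + 2"
    using K by (metis add.commute le_Suc_ex)
  have "n + i * m + (n - m) = 2 * n - 3 * m + (i + 2) * m"
    using mn by (simp add: add_mult_distrib)
  moreover have "max (n - m) m = m"
    using mn by simp
  ultimately have "n + (K - 2) * max (n - m) m + (n - m) = 2 * n - 3 * m + K * m"
    by (simp only: i add_diff_cancel_right')
  then show "(\<Sum>k\<in>{1..K}. R k) \<le> real K * (real (2 * n - 3 * m + K * m) / real K)"
    if "achievable K n m R" for R
    using sum_rate_bound_le[OF that K] K mn by simp
qed simp

text \<open>With truncated subtraction \<open>max n m + (n - m)\<close> is \<open>2 * n - m\<close>
  for \<open>m \<le> n\<close> and \<open>m\<close> otherwise, so two branches of the formula are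
  treated at once.\<close>

lemma fb_sym_capacity_two_thirds_to_two:
  assumes K: "K \<ge> 2" and mn: "2 * n \<le> 3 * m" "m \<le> 2 * n"
  shows "fb_sym_capacity K n m = real (max n m + (n - m)) / 2 / real n"
proof (rule fb_sym_capacity_eqI[OF K])
  show "achievable K n m (\<lambda>k. real (max n m + (n - m)) / 2)"
  proof (cases "m = n")
    case True
    then show ?thesis
      using alternating_achievable[OF K, of n] by simp
  next
    case False
    then have "achievable K n m (\<lambda>k. real (m + 2 * (max n m - m)) / 2)"
      using mn by (intro layered_achievable[OF _ refl]) auto
    moreover have "m + 2 * (max n m - m) = max n m + (n - m)"
      by auto
    ultimately show ?thesis by (simp only:)
  qed
  show "(\<Sum>k\<in>{1..K}. R k) \<le> real K * (real (max n m + (n - m)) / 2)"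
    if "achievable K n m R" for R
    using sum_rate_bound_pairs[OF that K] by simp
qed simp

lemma fb_sym_capacity_ge_two:
  assumes K: "K \<ge> 2" and n: "n \<ge> 1" and mn: "2 * n \<le> m"
  shows "fb_sym_capacity K n m = real (m - 2 * n + K * n) / real K / real n"
proof (rule fb_sym_capacity_eqI[OF K])
  have "achievable K n m (\<lambda>k. real (card {n..<m - n} + K * card {..<n}) / real K)"
    by (rule relay_achievable_ge) (use K n mn in auto)
  moreover have "card {n..<m - n} = m - 2 * n"
    by simp
  ultimately show "achievable K n m (\<lambda>k. real (m - 2 * n + K * n) / real K)"
    by (simp only: card_lessThan)
  obtain i where i: "K = i + 2"
    using K by (metis add.commute le_Suc_ex)
  obtain j where j: "m = 2 * n + j"
    using mn le_Suc_ex by blast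
  have "m + (K - 2) * n = m - 2 * n + K * n"
    by (simp add: i j algebra_simps)
  then show "(\<Sum>k\<in>{1..K}. R k) \<le> real K * (real (m - 2 * n + K * n) / real K)"
    if "achievable K n m R" for R
    using sum_rate_bound_gt[OF that K] K n mn by simp
qed simp

theorem theorem1:
  fixes K n m :: nat and \<alpha> :: real
  assumes "K \<ge> 2" and "n \<ge> 1" and "\<alpha> = real m / real n"
  shows "(0 \<le> \<alpha> \<and> \<alpha> \<le> 1/2 \<longrightarrow> fb_sym_capacity K n m = (1 - \<alpha>) + \<alpha> / real K) \<and>
         (1/2 \<le> \<alpha> \<and> \<alpha> \<le> 2/3 \<longrightarrow> fb_sym_capacity K n m = \<alpha> + (2 - 3 * \<alpha>) / real K) \<and>
         (2/3 \<le> \<alpha> \<and> \<alpha> \<le> 1 \<longrightarrow> fb_sym_capacity K n m = 1 - \<alpha> / 2) \<and>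
         (1 \<le> \<alpha> \<and> \<alpha> \<le> 2 \<longrightarrow> fb_sym_capacity K n m = \<alpha> / 2) \<and>
         (\<alpha> \<ge> 2 \<longrightarrow> fb_sym_capacity K n m = 1 + (\<alpha> - 2) / real K)"
proof -
  note K = assms(1) and n = assms(2)
  have pos: "real n > 0" "real K > 0"
    using K n by auto
  have m: "real m = \<alpha> * real n"
    using assms(3) pos by simp
  have cancel: "x * real n / real K / real n = x / real K" for x
    using pos by simp
  \<comment> \<open>Thresholds on \<alpha> become inequalities between multiples of \<open>m\<close>
    and \<open>n\<close>.\<close>
  have le_iff: "a * m \<le> b * n \<longleftrightarrow> real a * \<alpha> \<le> real b" "b * n \<le> a * m \<longleftrightarrow> real b \<le> real a * \<alpha>"
    for a b :: nat
  proof -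
    have "real a * real m = (real a * \<alpha>) * real n"
      by (simp add: m)
    then show "a * m \<le> b * n \<longleftrightarrow> real a * \<alpha> \<le> real b" "b * n \<le> a * m \<longleftrightarrow> real b \<le> real a * \<alpha>"
      using pos by (metis mult_le_cancel_right_pos of_nat_le_iff of_nat_mult)+
  qed
  have "fb_sym_capacity K n m = (1 - \<alpha>) + \<alpha> / real K" if "\<alpha> \<le> 1/2"
  proof -
    have "2 * m \<le> n"
      using le_iff(1)[of 2 1] that by simp
    moreover from this have "real (m + K * (n - m)) = real m + real K * (real n - real m)"
      by (simp add: of_nat_diff)
    then have "real (m + K * (n - m)) = (\<alpha> + real K * (1 - \<alpha>)) * real n"
      unfolding m by (simp add: algebra_simps)
    ultimately have "fb_sym_capacity K n m = (\<alpha> + real K * (1 - \<alpha>)) / real K"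
      using fb_sym_capacity_le_half[OF K, of m n] by (simp only: cancel)
    then show ?thesis
      using pos by (simp add: add_divide_distrib)
  qed
  moreover have "fb_sym_capacity K n m = \<alpha> + (2 - 3 * \<alpha>) / real K" if "1/2 \<le> \<alpha>" "\<alpha> \<le> 2/3"
  proof -
    have "n \<le> 2 * m" "3 * m \<le> 2 * n"
      using le_iff(2)[of 1 2] le_iff(1)[of 3 2] that by simp_all
    moreover from this have "real (2 * n - 3 * m + K * m) = (2 - 3 * \<alpha> + real K * \<alpha>) * real n"
      by (simp add: of_nat_diff m algebra_simps)
    ultimately have "fb_sym_capacity K n m = (2 - 3 * \<alpha> + real K * \<alpha>) / real K"
      using fb_sym_capacity_half_to_two_thirds[OF K, of n m] by (simp only: cancel)
    then show ?thesis
      using pos by (simp add: add_divide_distrib)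
  qed
  moreover have "fb_sym_capacity K n m = 1 - \<alpha> / 2" if "2/3 \<le> \<alpha>" "\<alpha> \<le> 1"
  proof -
    have "2 * n \<le> 3 * m" "m \<le> n"
      using le_iff(2)[of 2 3] le_iff(1)[of 1 1] that by simp_all
    moreover from this have "real (max n m + (n - m)) = (2 - \<alpha>) * real n"
      by (simp add: of_nat_diff max_absorb1 m algebra_simps del: of_nat_max)
    then have "real (max n m + (n - m)) / 2 = (1 - \<alpha> / 2) * real n"
      by (simp only:) (simp add: field_simps)
    ultimately show ?thesis
      using fb_sym_capacity_two_thirds_to_two[OF K, of n m] pos by simp
  qed
  moreover have "fb_sym_capacity K n m = \<alpha> / 2" if "1 \<le> \<alpha>" "\<alpha> \<le> 2"
  proof -
    have "n \<le> m" "m \<le> 2 * n"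
      using le_iff(2)[of 1 1] le_iff(1)[of 1 2] that by simp_all
    then show ?thesis
      using fb_sym_capacity_two_thirds_to_two[OF K, of n m] pos
      by (simp add: max_absorb2 m del: of_nat_max)
  qed
  moreover have "fb_sym_capacity K n m = 1 + (\<alpha> - 2) / real K" if "2 \<le> \<alpha>"
  proof -
    have "2 * n \<le> m"
      using le_iff(2)[of 2 1] that by simp
    moreover from this have "real (m - 2 * n + K * n) = (\<alpha> - 2 + real K) * real n"
      by (simp add: of_nat_diff m algebra_simps)
    ultimately have "fb_sym_capacity K n m = (\<alpha> - 2 + real K) / real K"
      using fb_sym_capacity_ge_two[OF K n, of m] by (simp only: cancel)
    then show ?thesis
      using pos by (simp add: add_divide_distrib)
  qed
  ultimately show ?thesis by blast
qed

end
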